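(* Let $d\ge1$, let $\mathcal K\subseteq\mathbb R^d$ be a compact convex set of diameter $1$, let $L>0$, and let $\mathcal L$ be a family of $L$-Lipschitz loss functions $\ell:\mathcal K\to\mathbb R$. There is a constant $C_d$ depending only on $d$ such that for every $T\ge2$ there is an online algorithm outputting finitely supported distributions $\mathbf x_t\in\Delta(\mathcal K)$ whose full swap regret, against every (possibly adaptive) sequence $\ell_1,\dots,\ell_T\in\mathcal L$, satisfies: (i) with no further assumption: $\mathrm{FullSwapReg}\le C_d\,L\,T^{\frac{d+1}{d+2}}\log T$; (ii) if every $\ell\in\mathcal L$ is $\beta$-smooth: $\mathrm{FullSwapReg}\le C_d\,(L+\beta)\,T^{\frac{d+2}{d+4}}\log T$; (iii) if every $\ell\in\mathcal L$ is concave (in particular linear): $\mathrm{FullSwapReg}\le C_d\,L\,T^{\frac{d+1}{d+3}}\log T$; (iv) if every $\ell\in\mathcal L$ is $\alpha$-strongly convex: $\mathrm{FullSwapReg}\le C_d\,L\,(L/\alpha)^{\frac1{d+1}}\,T^{\frac d{d+1}}\log T$; (v) if every $\ell\in\mathcal L$ is $\alpha$-strongly convex and $\beta$-smooth: $\mathrm{FullSwapReg}\le C_d\,L\,\big(\tfrac{\beta}{L}+\tfrac{L}{\alpha}\big)\,T^{\frac d{d+2}}\log T$. (The algorithm may depend on $T,d,L,\alpha,\beta$ and $\mathcal K$.)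
   Context: Online protocol: in each round $t=1,\dots,T$ the learner, knowing $\ell_1,\dots,\ell_{t-1}$, outputs a finitely supported probability distribution $\mathbf x_t$ on $\mathcal K$; then the adversary, knowing $\mathbf x_1,\dots,\mathbf x_t$, reveals $\ell_t\in\mathcal L$. The full swap regret is $$\mathrm{FullSwapReg}(\mathbf x_{1:T},\ell_{1:T})=\sup_{\phi:\mathcal K\to\mathcal K}\sum_{t=1}^T\Big(\mathbb E_{s\sim\mathbf x_t}[\ell_t(s)]-\mathbb E_{s\sim\mathbf x_t}[\ell_t(\phi(s))]\Big),$$ the supremum over all (arbitrary) maps $\phi$. A function $\ell$ is $L$-Lipschitz if $|\ell(x)-\ell(y)|\le L\|x-y\|_2$; $\alpha$-strongly convex if for all $x,y\in\mathcal K$ and every subgradient $\nabla\ell(x)$, $\ell(y)-\ell(x)-\nabla\ell(x)^\top(y-x)\ge\frac\alpha2\|y-x\|^2$; $\beta$-smooth if it is differentiable and $\ell(y)-\ell(x)-\nabla\ell(x)^\top(y-x)\le\frac\beta2\|y-x\|^2$ for all $x,y\in\mathcal K$. *)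

theory Defs
  imports "HOL-Analysis.Analysis" "HOL-Probability.Probability"
begin

definition strongly_convex_on :: "real \<Rightarrow> 'a::euclidean_space set \<Rightarrow> ('a \<Rightarrow> real) \<Rightarrow> bool" where
  "strongly_convex_on \<alpha> K f \<longleftrightarrow> convex_on K f \<and>
     (\<forall>x\<in>K. \<forall>y\<in>K. \<forall>g. (\<forall>z\<in>K. f z \<ge> f x + g \<bullet> (z - x)) \<longrightarrow>
        f y - f x - g \<bullet> (y - x) \<ge> \<alpha> / 2 * (norm (y - x))\<^sup>2)"

definition smooth_on :: "real \<Rightarrow> 'a::euclidean_space set \<Rightarrow> ('a \<Rightarrow> real) \<Rightarrow> bool" where
  "smooth_on \<beta> K f \<longleftrightarrow> (\<exists>g. (\<forall>x\<in>K. (f has_derivative (\<lambda>h. g x \<bullet> h)) (at x within K)) \<and>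
     (\<forall>x\<in>K. \<forall>y\<in>K. f y - f x - g x \<bullet> (y - x) \<le> \<beta> / 2 * (norm (y - x))\<^sup>2))"

definition full_swap_reg :: "'a set \<Rightarrow> (nat \<Rightarrow> 'a pmf) \<Rightarrow> (nat \<Rightarrow> 'a \<Rightarrow> real) \<Rightarrow> nat \<Rightarrow> real" where
  "full_swap_reg K x l T = (SUP \<phi> \<in> {\<phi>. \<forall>s\<in>K. \<phi> s \<in> K}.
     (\<Sum>t=1..T. measure_pmf.expectation (x t) (l t)
               - measure_pmf.expectation (x t) (\<lambda>s. l t (\<phi> s))))"

text \<open>A (deterministic) learner maps the history of revealed losses (restricted to K)
  to a finitely supported distribution on K.\<close>
definition valid_learner :: "'a set \<Rightarrow> (('a \<Rightarrow> real) list \<Rightarrow> 'a pmf) \<Rightarrow> bool" where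
  "valid_learner K A \<longleftrightarrow> (\<forall>h. finite (set_pmf (A h)) \<and> set_pmf (A h) \<subseteq> K)"

definition play :: "'a set \<Rightarrow> (('a \<Rightarrow> real) list \<Rightarrow> 'a pmf) \<Rightarrow> (nat \<Rightarrow> 'a \<Rightarrow> real) \<Rightarrow> nat \<Rightarrow> 'a pmf" where
  "play K A l t = A (map (\<lambda>s x. if x \<in> K then l s x else 0) [1..<t])"

definition achieves :: "'a set \<Rightarrow> ('a \<Rightarrow> real) set \<Rightarrow> nat \<Rightarrow> real \<Rightarrow> bool" where
  "achieves K Ls T B \<longleftrightarrow> (\<exists>A. valid_learner K A \<and>
     (\<forall>l. (\<forall>t\<in>{1..T}. l t \<in> Ls) \<longrightarrow> full_swap_reg K (play K A l) l T \<le> B))"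

end

theory Submission
  imports Defs
begin

text \<open>
  Fix a finite set \<open>S\<close> such that every point \<open>y\<close> of \<open>K\<close> can be rounded to a distribution \<open>q\<close> on
  \<open>S\<close> with \<open>E\<^sub>q l \<le> l y + e\<close> for all losses. By the reduction of Blum and Mansour, one keeps for
  every \<open>s \<in> S\<close> an external-regret algorithm, fed with the losses weighted by the probability of
  \<open>s\<close>, and plays an almost stationary distribution of the Markov chain formed by the (rounded)
  recommendations. Full swap regret is then at most \<open>e T\<close> plus the sum of the external regrets:
  \<open>L sqrt (|S| T log |S|)\<close> for Hedge on \<open>S\<close>, and \<open>|S| (L\<^sup>2 / \<alpha>) log T\<close> for follow-the-leader under
  strong convexity.

  Rounding sets come from Dudley's theorem: a compact convex set in dimension \<open>n\<close> lies within
  \<open>\<delta>\<close> of the hull of \<open>O (\<delta> powr (-(n-1)/2))\<close> of its points. For concave losses it is applied to \<open>K\<close>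
  itself. Applied in dimension \<open>d + 1\<close> with \<open>\<delta> = \<epsilon>\<^sup>2\<close> to a paraboloid cap over \<open>K\<close>, it yields
  \<open>O (\<epsilon> powr -d)\<close> points such that every \<open>y\<close> is within \<open>\<epsilon>\<^sup>2\<close> of the mean of a distribution on them of
  variance \<open>O (\<epsilon>\<^sup>2)\<close>; this costs \<open>e = O (L \<epsilon>)\<close> in general and \<open>e = O ((L + \<beta>) \<epsilon>\<^sup>2)\<close> for smooth losses.
\<close>

subsection \<open>Dudley's approximation of convex bodies\<close>

text \<open>Only the frontier of the cube of half-side 3 is netted: on each face one coordinate is
  frozen and the others run through a grid of \<open>n + 1\<close> values. The power
  \<open>DIM('b) - 1\<close> is the source of the exponent in Dudley's bound.\<close>

lemma box_frontier_net:
  fixes c :: "'b::euclidean_space"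
  assumes n: "n \<ge> (1::nat)"
  obtains Z where "finite Z" "card Z \<le> 2 * DIM('b) * (n + 1) ^ (DIM('b) - 1)"
    "\<And>z. infnorm (z - c) = 3 \<Longrightarrow> \<exists>z'\<in>Z. norm (z - z') \<le> 6 * DIM('b) / n"
proof -
  define V where "V = (\<lambda>j::nat. -3 + 6 * real j / n) ` {..n}"
  \<comment> \<open>\<open>F b0\<close> holds the grid coordinates on the two opposite faces
    orthogonal to \<open>b0\<close>.\<close>
  define F where "F = (\<lambda>b0::'b. PiE Basis (\<lambda>b. if b = b0 then {3,-3::real} else V))"
  define Z where "Z = (\<lambda>f. c + (\<Sum>b\<in>Basis. f b *\<^sub>R b)) ` (\<Union>b0\<in>Basis. F b0)"
  have V: "finite V" "card V \<le> n + 1"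
    unfolding V_def using card_image_le[of "{..n}" "\<lambda>j::nat. -3 + 6 * real j / n"] by auto
  have finF: "finite (F b0)" for b0
    unfolding F_def by (rule finite_PiE) (auto simp: V)
  have cardF: "card (F b0) \<le> 2 * (n + 1) ^ (DIM('b) - 1)" if "b0 \<in> Basis" for b0
  proof -
    have "card (F b0) = (\<Prod>b\<in>Basis. card (if b = b0 then {3,-3::real} else V))"
      unfolding F_def by (rule card_PiE) simp
    also have "\<dots> = 2 * (\<Prod>b\<in>Basis - {b0}. card (if b = b0 then {3,-3::real} else V))"
      using that by (subst prod.remove[where x = b0]) auto
    also have "(\<Prod>b\<in>Basis - {b0}. card (if b = b0 then {3,-3::real} else V)) = (\<Prod>b\<in>Basis - {b0}. card V)"
      by (rule prod.cong) auto
    also have "\<dots> = card V ^ (DIM('b) - 1)"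
      using that by simp
    also have "\<dots> \<le> (n + 1) ^ (DIM('b) - 1)"
      by (rule power_mono) (use V in auto)
    finally show ?thesis by simp
  qed
  have round: "\<exists>v'\<in>V. \<bar>v - v'\<bar> \<le> 6 / n" if "\<bar>v\<bar> \<le> 3" for v
  proof -
    define w where "w = (v + 3) * n / 6"
    define j where "j = nat \<lfloor>w\<rfloor>"
    have "(v + 3) * real n \<le> 6 * real n" using that by (intro mult_right_mono) auto
    then have w: "0 \<le> w" "w \<le> n" using that by (auto simp: w_def)
    have j: "real j = of_int \<lfloor>w\<rfloor>" using w by (simp add: j_def)
    have "real j \<le> n" using w(2) j by linarith
    then have jn: "j \<le> n" by simp
    have veq: "v = -3 + 6 * w / n" using n by (simp add: w_def field_simps)
    have "v - (-3 + 6 * real j / n) = 6 * (w - j) / n"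
      unfolding veq by (simp add: diff_divide_distrib right_diff_distrib)
    then have "\<bar>v - (-3 + 6 * real j / n)\<bar> = 6 * \<bar>w - j\<bar> / n"
      by (simp only: abs_divide abs_mult abs_numeral abs_of_nat)
    also have "\<dots> \<le> 6 * 1 / n"
      using j w by (intro divide_right_mono mult_left_mono) linarith+
    finally show ?thesis using jn by (auto simp: V_def)
  qed
  have "\<exists>z'\<in>Z. norm (z - z') \<le> 6 * DIM('b) / n" if z: "infnorm (z - c) = 3" for z
  proof -
    have le: "\<bar>(z - c) \<bullet> b\<bar> \<le> 3" if "b \<in> Basis" for b
      using Basis_le_infnorm[OF that, of "z - c"] z by simp
    have "infnorm (z - c) \<in> (\<lambda>i. \<bar>(z - c) \<bullet> i\<bar>) ` Basis"
      unfolding infnorm_Max by (rule Max_in) auto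
    then obtain b0 where b0: "b0 \<in> Basis" "\<bar>(z - c) \<bullet> b0\<bar> = 3" using z by auto
    have "\<forall>b\<in>Basis. \<exists>v'\<in>V. \<bar>(z - c) \<bullet> b - v'\<bar> \<le> 6 / n"
      using le round by blast
    then obtain r where r: "\<And>b. b \<in> Basis \<Longrightarrow> r b \<in> V \<and> \<bar>(z - c) \<bullet> b - r b\<bar> \<le> 6 / n"
      by metis
    define f where "f = restrict (\<lambda>b. if b = b0 then (z - c) \<bullet> b0 else r b) Basis"
    have "f \<in> F b0" unfolding F_def f_def using r b0 by auto
    then have mem: "c + (\<Sum>b\<in>Basis. f b *\<^sub>R b) \<in> Z" using b0 unfolding Z_def by blast
    have "norm (z - (c + (\<Sum>b\<in>Basis. f b *\<^sub>R b))) \<le> (\<Sum>b\<in>Basis. \<bar>(z - (c + (\<Sum>b\<in>Basis. f b *\<^sub>R b))) \<bullet> b\<bar>)"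
      by (rule norm_le_l1)
    also have "\<dots> = (\<Sum>b\<in>Basis. \<bar>(z - c) \<bullet> b - f b\<bar>)"
      by (rule sum.cong) (auto simp: inner_diff_left inner_add_left inner_sum_left_Basis)
    also have "\<dots> \<le> (\<Sum>b\<in>(Basis::'b set). 6 / n)"
      by (rule sum_mono) (use r in \<open>auto simp: f_def\<close>)
    also have "\<dots> = 6 * DIM('b) / n" by simp
    finally show ?thesis using mem by blast
  qed
  moreover have "finite Z" unfolding Z_def by (auto simp: finF)
  moreover have "card Z \<le> 2 * DIM('b) * (n + 1) ^ (DIM('b) - 1)"
  proof -
    have "card Z \<le> card (\<Union>b0\<in>Basis. F b0)"
      unfolding Z_def by (rule card_image_le) (auto simp: finF)
    also have "\<dots> \<le> (\<Sum>b0\<in>Basis. card (F b0))" by (rule card_UN_le) simp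
    also have "\<dots> \<le> (\<Sum>b0\<in>(Basis::'b set). 2 * (n + 1) ^ (DIM('b) - 1))" by (rule sum_mono) (rule cardF)
    finally show ?thesis by (simp add: mult_ac)
  qed
  ultimately show thesis using that by blast
qed

text \<open>The frontier of the cube is at Euclidean distance at least 3 from \<open>c\<close>, and
  \<open>x\<close> is at distance at most 2, so the ray travels at least 1. This later allows
  dropping the factor \<open>s\<close>.\<close>

lemma ray_hits_box_frontier:
  fixes x u c :: "'b::euclidean_space"
  assumes x: "x \<in> cball c 2" and u: "norm u = 1"
  obtains s where "s \<ge> 1" "infnorm (x + s *\<^sub>R u - c) = 3"
proof -
  \<comment> \<open>After length \<open>B\<close> the ray is at Euclidean distance at least
    \<open>3 * sqrt DIM('b)\<close> from \<open>c\<close>, which forces \<open>infnorm\<close> to be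
    at least 3; the intermediate value theorem does the rest.\<close>
  define B where "B = 3 * sqrt DIM('b) + 2"
  have nx: "norm (x - c) \<le> 2" using x by (simp add: dist_norm norm_minus_commute)
  have "infnorm (x + 0 *\<^sub>R u - c) \<le> 3" using infnorm_le_norm[of "x - c"] nx by simp
  moreover have "3 \<le> infnorm (x + B *\<^sub>R u - c)"
  proof -
    have "norm (B *\<^sub>R u) \<le> norm (x + B *\<^sub>R u - c) + norm (x - c)"
      using norm_triangle_ineq4[of "x + B *\<^sub>R u - c" "x - c"] by (simp add: algebra_simps)
    then have "B \<le> norm (x + B *\<^sub>R u - c) + 2" using u nx by (simp add: B_def)
    also have "norm (x + B *\<^sub>R u - c) \<le> sqrt DIM('b) * infnorm (x + B *\<^sub>R u - c)"
      by (rule norm_le_infnorm)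
    finally have "sqrt DIM('b) * 3 \<le> sqrt DIM('b) * infnorm (x + B *\<^sub>R u - c)" by (simp add: B_def)
    then show ?thesis by simp
  qed
  moreover have "continuous_on {0..B} (\<lambda>s. infnorm (x + s *\<^sub>R u - c))"
    by (intro continuous_intros)
  ultimately obtain s where s: "0 \<le> s" "infnorm (x + s *\<^sub>R u - c) = 3"
    using IVT'[of "\<lambda>s. infnorm (x + s *\<^sub>R u - c)" 0 3 B] by (auto simp: B_def)
  have "3 \<le> norm (x + s *\<^sub>R u - c)" using infnorm_le_norm[of "x + s *\<^sub>R u - c"] s by simp
  also have "\<dots> \<le> norm (x - c) + norm (s *\<^sub>R u)"
    using norm_triangle_ineq[of "x - c" "s *\<^sub>R u"] by (simp add: algebra_simps)
  finally have "s \<ge> 1" using nx u s by simp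
  then show thesis using that s by blast
qed

text \<open>
  If \<open>x\<close> were far from the hull, in direction \<open>u\<close>, consider the point of \<open>K\<close> extreme in direction
  \<open>u\<close>: the ray from it along \<open>u\<close> leaves the box near a net point, whose projection is close to the
  extreme point, with an error in direction \<open>u\<close> that is quadratic in the mesh.
\<close>

lemma convex_hull_of_projections_dense:
  fixes K Z :: "'b::euclidean_space set"
  assumes K: "compact K" "convex K" "K \<noteq> {}" "K \<subseteq> cball c 2"
    and Z: "finite Z" and r: "r \<ge> 0"
    and net: "\<And>z. infnorm (z - c) = 3 \<Longrightarrow> \<exists>z'\<in>Z. norm (z - z') \<le> r"
    and x: "x \<in> K"
  shows "\<exists>x'\<in>convex hull (closest_point K ` Z). dist x x' \<le> r\<^sup>2"
proof -
  define H where "H = convex hull (closest_point K ` Z)"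
  have clK: "closed K" using K compact_imp_closed by auto
  obtain x1 where x1: "x1 \<in> K" using K by auto
  obtain b1 :: 'b where "b1 \<in> Basis" using nonempty_Basis by blast
  then have "norm b1 = 1" by simp
  then obtain s1 where "infnorm (x1 + s1 *\<^sub>R b1 - c) = 3"
    using ray_hits_box_frontier[of x1 c b1] x1 K by blast
  then have "Z \<noteq> {}" using net by blast
  then have Hne: "H \<noteq> {}" unfolding H_def by simp
  have clH: "closed H" unfolding H_def by (intro compact_imp_closed compact_convex_hull finite_imp_compact finite_imageI Z)
  have cvH: "convex H" unfolding H_def by simp
  define y where "y = closest_point H x"
  have yH: "y \<in> H" unfolding y_def by (rule closest_point_in_set[OF clH Hne])
  show ?thesis
  proof (cases "x = y")
    case True
    then show ?thesis using yH r unfolding H_def by (intro bexI[of _ y]) auto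
  next
    case False
    define h where "h = norm (x - y)"
    have h: "h > 0" using False by (simp add: h_def)
    define u where "u = (x - y) /\<^sub>R h"
    have u: "norm u = 1" using h by (simp add: u_def h_def)
    have sep: "u \<bullet> p \<le> u \<bullet> x - h" if "p \<in> H" for p
    proof -
      have "(x - y) \<bullet> (p - y) \<le> 0" unfolding y_def by (rule closest_point_dot[OF cvH clH that])
      then have "u \<bullet> (p - y) \<le> 0" using h by (simp add: u_def mult_nonneg_nonpos)
      moreover have "u \<bullet> (x - y) = h" using h by (simp add: u_def h_def dot_square_norm power2_eq_square)
      ultimately show ?thesis by (simp add: inner_diff_right)
    qed
    have "continuous_on K (\<lambda>y. u \<bullet> y)" by (intro continuous_intros)
    then obtain xs where xs: "xs \<in> K" "\<And>y. y \<in> K \<Longrightarrow> u \<bullet> y \<le> u \<bullet> xs"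
      using continuous_attains_sup[of K "\<lambda>y. u \<bullet> y", OF K(1,3)] by blast
    obtain s where s: "s \<ge> 1" "infnorm (xs + s *\<^sub>R u - c) = 3"
      using ray_hits_box_frontier[of xs c u] xs K u by blast
    define zs where "zs = xs + s *\<^sub>R u"
    obtain z where z: "z \<in> Z" "norm (zs - z) \<le> r" using net s unfolding zs_def by blast
    define p where "p = closest_point K z"
    have pH: "p \<in> H" unfolding H_def p_def by (rule hull_inc) (use z in auto)
    define a where "a = norm (xs - p)"
    have 1: "(z - p) \<bullet> (xs - p) \<le> 0" unfolding p_def by (rule closest_point_dot[OF K(2) clK xs(1)])
    have 2: "(zs - z) \<bullet> (xs - p) \<le> r * a"
      using norm_cauchy_schwarz[of "zs - z" "xs - p"] z(2) mult_right_mono[of "norm (zs - z)" r a]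
      by (auto simp: a_def)
    \<comment> \<open>The step along \<open>u\<close> splits into net error, projection residual and
      \<open>p - xs\<close>. Paired with \<open>xs - p\<close> they contribute at most
      \<open>r * a\<close>, at most 0 (obtuse angle at a projection) and minus the square of
      \<open>a\<close>.\<close>
    have "s *\<^sub>R u = (zs - z) + (z - p) - (xs - p)" by (simp add: zs_def)
    then have "s * (u \<bullet> (xs - p)) = ((zs - z) + (z - p) - (xs - p)) \<bullet> (xs - p)"
      by (metis inner_scaleR_left)
    also have "\<dots> = (zs - z) \<bullet> (xs - p) + (z - p) \<bullet> (xs - p) - a\<^sup>2"
      unfolding a_def by (simp only: inner_diff_left[of _ "xs - p"] inner_add_left dot_square_norm)
    also have "\<dots> \<le> r * a - a\<^sup>2" using 1 2 by simp
    also have "\<dots> \<le> r\<^sup>2"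
    proof -
      have "0 \<le> r * a" using r by (simp add: a_def)
      then show ?thesis using zero_le_power2[of "r - a"] unfolding power2_diff by linarith
    qed
    finally have "s * (u \<bullet> (xs - p)) \<le> r\<^sup>2" .
    \<comment> \<open>In direction \<open>u\<close> the point \<open>xs\<close> is at least as high
      as \<open>x\<close>, while the whole hull lies \<open>h\<close> below
      \<open>x\<close>.\<close>
    moreover have up: "u \<bullet> (xs - p) \<ge> h"
      using sep[OF pH] xs(2)[OF x] by (simp add: inner_diff_right)
    moreover have "1 * (u \<bullet> (xs - p)) \<le> s * (u \<bullet> (xs - p))"
      by (rule mult_right_mono) (use s up h in linarith)+
    ultimately have "dist x y \<le> r\<^sup>2" using up unfolding h_def dist_norm by linarith
    then show ?thesis using yH unfolding H_def by blast
  qed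
qed

text \<open>The error is the square of the mesh, so mesh \<open>sqrt \<delta>\<close> suffices, and
  the net has order \<open>(1 / sqrt \<delta>) ^ (D - 1)\<close> points. Radius 2 leaves room for
  the paraboloid cap over a body of diameter 1.\<close>

theorem dudley_inner_approximation:
  "\<exists>C>0. \<forall>(K::'b::euclidean_space set) c \<delta>. compact K \<and> convex K \<and> K \<noteq> {} \<and> K \<subseteq> cball c 2 \<and> 0 < \<delta> \<and> \<delta> \<le> 1 \<longrightarrow>
    (\<exists>S. finite S \<and> S \<noteq> {} \<and> S \<subseteq> K \<and> real (card S) \<le> C * \<delta> powr (- (real DIM('b) - 1) / 2) \<and>
      (\<forall>x\<in>K. \<exists>x'\<in>convex hull S. dist x x' \<le> \<delta>))"
proof -
  define D where "D = DIM('b)"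
  have D: "D \<ge> 1" unfolding D_def by simp
  define C where "C = 2 * real D * (6 * real D + 2) ^ (D - 1)"
  have "C > 0" using D by (auto simp: C_def)
  moreover have "\<exists>S. finite S \<and> S \<noteq> {} \<and> S \<subseteq> K \<and> real (card S) \<le> C * \<delta> powr (- (real DIM('b) - 1) / 2) \<and>
      (\<forall>x\<in>K. \<exists>x'\<in>convex hull S. dist x x' \<le> \<delta>)"
    if K: "compact K" "convex K" "K \<noteq> {}" "K \<subseteq> cball c 2" and \<delta>: "0 < \<delta>" "\<delta> \<le> 1"
    for K :: "'b set" and c \<delta>
  proof -
    define n where "n = nat \<lceil>6 * D / sqrt \<delta>\<rceil>"
    have q: "0 < 6 * D / sqrt \<delta>" using D \<delta> by simp
    have n1: "6 * D / sqrt \<delta> \<le> n" "n \<le> 6 * D / sqrt \<delta> + 1" using q unfolding n_def by linarith+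
    have n: "n \<ge> 1" using n1 q by linarith
    obtain Z where Z: "finite Z" "card Z \<le> 2 * DIM('b) * (n + 1) ^ (DIM('b) - 1)"
      and net0: "\<And>z. infnorm (z - c) = 3 \<Longrightarrow> \<exists>z'\<in>Z. norm (z - z') \<le> 6 * DIM('b) / n"
      using box_frontier_net[OF n, where c = c] by blast
    have "6 * D / n \<le> sqrt \<delta>" using n1 n \<delta> by (simp add: field_simps)
    then have net: "\<exists>z'\<in>Z. norm (z - z') \<le> sqrt \<delta>" if "infnorm (z - c) = 3" for z
      using net0[OF that] unfolding D_def by force
    define S where "S = closest_point K ` Z"
    have dense: "\<exists>x'\<in>convex hull S. dist x x' \<le> \<delta>" if "x \<in> K" for x
      using convex_hull_of_projections_dense[OF K Z(1) _ net that] \<delta> unfolding S_def by simp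
    have S1: "finite S" unfolding S_def using Z by simp
    have S2: "S \<subseteq> K" unfolding S_def using closest_point_in_set[of K] K compact_imp_closed by blast
    have S3: "S \<noteq> {}" using dense K by fastforce
    have sq: "sqrt \<delta> = \<delta> powr (1/2)" using \<delta> by (simp add: powr_half_sqrt)
    \<comment> \<open>By \<open>\<delta> \<le> 1\<close> the additive constant from rounding
      \<open>n\<close> up is absorbed into a multiple of \<open>1 / sqrt \<delta>\<close>.\<close>
    have i: "1 \<le> 1 / sqrt \<delta>" using \<delta> by simp
    have "card S \<le> 2 * D * (n + 1) ^ (D - 1)"
      using card_image_le[OF Z(1), of "closest_point K"] Z(2) unfolding S_def D_def by linarith
    then have "real (card S) \<le> real (2 * D * (n + 1) ^ (D - 1))" by (rule of_nat_mono)
    also have "\<dots> = 2 * D * (real n + 1) ^ (D - 1)" by (simp add: add.commute)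
    also have "\<dots> \<le> 2 * D * ((6 * D + 2) * (1 / sqrt \<delta>)) ^ (D - 1)"
    proof (intro mult_left_mono power_mono)
      have "real n + 1 \<le> 6 * D / sqrt \<delta> + 2" using n1 by simp
      also have "\<dots> \<le> 6 * D / sqrt \<delta> + 2 * (1 / sqrt \<delta>)" using i by simp
      finally show "real n + 1 \<le> (6 * D + 2) * (1 / sqrt \<delta>)" by (simp add: add_divide_distrib)
    qed auto
    also have "\<dots> = C * (1 / sqrt \<delta>) ^ (D - 1)" by (simp add: C_def power_mult_distrib power_divide add.commute)
    also have "(1 / sqrt \<delta>) ^ (D - 1) = (1 / sqrt \<delta>) powr (real (D - 1))"
      using \<delta> by (subst powr_realpow) auto
    also have "\<dots> = \<delta> powr (- (1 / 2) * real (D - 1))"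
      using \<delta> unfolding sq by (simp add: powr_minus_divide[symmetric] powr_powr)
    also have "- (1 / 2) * real (D - 1) = - (real DIM('b) - 1) / 2"
    proof -
      have "real (D - 1) = real DIM('b) - 1" using D by (simp add: D_def of_nat_diff)
      moreover have "- (1 / 2) * x = - x / 2" for x :: real by simp
      ultimately show ?thesis by metis
    qed
    finally show ?thesis using S1 S2 S3 dense by blast
  qed
  ultimately show ?thesis by blast
qed

subsection \<open>From external to swap regret\<close>

definition weighted_pmf :: "'a set \<Rightarrow> ('a \<Rightarrow> real) \<Rightarrow> 'a pmf" where
  "weighted_pmf S u = embed_pmf (\<lambda>s. if s \<in> S then u s else 0)"

lemma pmf_weighted_pmf:
  assumes "finite S" "\<And>s. s \<in> S \<Longrightarrow> u s \<ge> 0" "sum u S = 1"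
  shows "pmf (weighted_pmf S u) s = (if s \<in> S then u s else 0)"
proof -
  have "(\<integral>\<^sup>+ x. ennreal (if x \<in> S then u x else 0) \<partial>count_space UNIV) =
      (\<Sum>x\<in>S. ennreal (if x \<in> S then u x else 0))"
    by (rule nn_integral_count_space'[OF assms(1)]) auto
  also have "\<dots> = ennreal (sum u S)"
    using assms by (subst sum_ennreal[symmetric]) auto
  finally show ?thesis
    unfolding weighted_pmf_def using assms by (subst pmf_embed_pmf) auto
qed

lemma set_weighted_pmf:
  assumes "finite S" "\<And>s. s \<in> S \<Longrightarrow> u s \<ge> 0" "sum u S = 1"
  shows "set_pmf (weighted_pmf S u) \<subseteq> S"
  using pmf_weighted_pmf[OF assms] by (auto simp: set_pmf_eq split: if_splits)

lemma expectation_finite_pmf: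
  fixes f :: "'a \<Rightarrow> real"
  assumes "finite S" "set_pmf p \<subseteq> S"
  shows "measure_pmf.expectation p f = (\<Sum>s\<in>S. pmf p s * f s)"
  using integral_measure_pmf[OF assms(1), of p f] assms(2) by auto

lemma pmf_of_convex_hull:
  fixes S :: "'a::real_vector set"
  assumes "finite S" "x \<in> convex hull S"
  obtains q where "set_pmf q \<subseteq> S" "(\<Sum>s\<in>S. pmf q s *\<^sub>R s) = x"
proof -
  obtain u where u: "\<forall>s\<in>S. 0 \<le> u s" "sum u S = 1" "(\<Sum>s\<in>S. u s *\<^sub>R s) = x"
    using assms by (auto simp: convex_hull_finite)
  have "(\<Sum>s\<in>S. pmf (weighted_pmf S u) s *\<^sub>R s) = (\<Sum>s\<in>S. u s *\<^sub>R s)"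
    by (rule sum.cong) (use pmf_weighted_pmf[of S u] assms u in auto)
  then show thesis
    using that[of "weighted_pmf S u"] set_weighted_pmf[of S u] assms u by auto
qed

text \<open>
  Averaging \<open>n\<close> steps of the chain replaces a stationary distribution and avoids proving its existence:
  the stationarity defect telescopes to \<open>O (1 / n)\<close>.
\<close>

definition cesaro_pmf :: "('a \<Rightarrow> 'a pmf) \<Rightarrow> 'a \<Rightarrow> nat \<Rightarrow> 'a pmf" where
  "cesaro_pmf Q s0 n = pmf_of_set {..<n} \<bind> (\<lambda>k. ((\<lambda>p. p \<bind> Q) ^^ k) (return_pmf s0))"

lemma set_iterated_kernel:
  assumes "s0 \<in> S" "\<And>s. s \<in> S \<Longrightarrow> set_pmf (Q s) \<subseteq> S"
  shows "set_pmf (((\<lambda>p. p \<bind> Q) ^^ k) (return_pmf s0)) \<subseteq> S"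
proof (induction k)
  case (Suc k)
  then show ?case using assms(2) by (fastforce simp: set_bind_pmf)
qed (use assms in simp)

lemma set_cesaro_pmf:
  assumes "n \<ge> 1" "s0 \<in> S" "\<And>s. s \<in> S \<Longrightarrow> set_pmf (Q s) \<subseteq> S"
  shows "set_pmf (cesaro_pmf Q s0 n) \<subseteq> S"
proof -
  have "{..<n} \<noteq> {}" using assms(1) by (simp add: lessThan_empty_iff)
  then show ?thesis
    unfolding cesaro_pmf_def using set_iterated_kernel[of s0 S Q] assms(2,3)
    by (auto simp: set_bind_pmf set_pmf_of_set)
qed

text \<open>One more step of the chain turns the average over steps \<open>0..<n\<close> into the
  average over steps \<open>1..n\<close>; only the two end terms differ. For regret this one-sided
  bound is enough.\<close>

lemma cesaro_pmf_almost_stationary: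
  fixes f :: "'a \<Rightarrow> real"
  assumes n: "n \<ge> 1" and S: "finite S" "s0 \<in> S" "\<And>s. s \<in> S \<Longrightarrow> set_pmf (Q s) \<subseteq> S"
    and f: "\<And>x y. x \<in> S \<Longrightarrow> y \<in> S \<Longrightarrow> \<bar>f x - f y\<bar> \<le> r"
  shows "measure_pmf.expectation (cesaro_pmf Q s0 n) f
    \<le> (\<Sum>s\<in>S. pmf (cesaro_pmf Q s0 n) s * measure_pmf.expectation (Q s) f) + r / n"
proof -
  define P where "P k = ((\<lambda>p. p \<bind> Q) ^^ k) (return_pmf s0)" for k
  define E where "E k = measure_pmf.expectation (P k) f" for k
  define g where "g s = measure_pmf.expectation (Q s) f" for s
  have PS: "set_pmf (P k) \<subseteq> S" for k unfolding P_def by (rule set_iterated_kernel[OF S(2,3)])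
  have fin: "finite (set_pmf (P k))" for k using PS S(1) finite_subset by blast
  have finQ: "finite (set_pmf (Q s))" if "s \<in> S" for s using S(1) S(3)[OF that] finite_subset by blast
  have ces: "measure_pmf.expectation (cesaro_pmf Q s0 n) h = (\<Sum>k<n. measure_pmf.expectation (P k) h) / n"
    for h :: "'a \<Rightarrow> real"
    unfolding cesaro_pmf_def P_def[symmetric] using n fin
    by (subst pmf_expectation_bind_pmf_of_set) (auto simp: sum_divide_distrib field_simps lessThan_empty_iff)
  have step: "E (Suc k) = measure_pmf.expectation (P k) g" for k
  proof -
    have "E (Suc k) = measure_pmf.expectation (P k \<bind> Q) f" by (simp add: E_def P_def)
    also have "\<dots> = (\<Sum>s\<in>S. pmf (P k) s * g s)"
      using pmf_expectation_bind[of S Q "P k" f] S(1) PS finQ by (simp add: g_def)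
    also have "\<dots> = measure_pmf.expectation (P k) g"
      by (rule expectation_finite_pmf[OF S(1) PS, symmetric])
    finally show ?thesis .
  qed
  have E0: "E 0 = f s0" by (simp add: E_def P_def)
  \<comment> \<open>\<open>E n\<close> averages values of \<open>f\<close> on \<open>S\<close>, all
    within \<open>r\<close> of \<open>f s0\<close>, which is \<open>E 0\<close>.\<close>
  have "E n \<ge> f s0 - r"
  proof -
    have "E n = (\<Sum>s\<in>S. pmf (P n) s * f s)" unfolding E_def by (rule expectation_finite_pmf[OF S(1) PS])
    also have "\<dots> \<ge> (\<Sum>s\<in>S. pmf (P n) s * (f s0 - r))"
      using f[OF S(2)] by (intro sum_mono mult_left_mono) (auto simp: abs_le_iff algebra_simps)
    also have "(\<Sum>s\<in>S. pmf (P n) s * (f s0 - r)) = f s0 - r"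
      using sum_pmf_eq_1[OF S(1) PS] by (simp add: sum_distrib_right[symmetric])
    finally show ?thesis .
  qed
  moreover have "(\<Sum>k<n. E k) - (\<Sum>k<n. E (Suc k)) = E 0 - E n"
    using sum_lessThan_telescope'[of E n] by (simp add: sum_subtractf)
  ultimately have "(\<Sum>k<n. E k) / n \<le> ((\<Sum>k<n. E (Suc k)) + r) / n"
    using E0 by (intro divide_right_mono) auto
  moreover have "measure_pmf.expectation (cesaro_pmf Q s0 n) f = (\<Sum>k<n. E k) / n"
    unfolding E_def by (rule ces)
  moreover have "(\<Sum>k<n. E (Suc k)) / n = measure_pmf.expectation (cesaro_pmf Q s0 n) g"
    unfolding step by (rule ces[symmetric])
  moreover have "\<dots> = (\<Sum>s\<in>S. pmf (cesaro_pmf Q s0 n) s * g s)"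
    by (rule expectation_finite_pmf[OF S(1) set_cesaro_pmf[OF n S(2,3)]])
  ultimately show ?thesis unfolding g_def by (simp add: add_divide_distrib)
qed

text \<open>Each \<open>s\<close> owns a copy of the base algorithm \<open>R\<close>; its
  recommendation is row \<open>s\<close> of the Markov chain.\<close>

definition swap_dist :: "(('a \<Rightarrow> real) \<Rightarrow> 'a pmf) \<Rightarrow> 'a \<Rightarrow> nat \<Rightarrow> ('a \<Rightarrow> 'a \<Rightarrow> real) \<Rightarrow> 'a pmf" where
  "swap_dist R s0 n G = cesaro_pmf (\<lambda>s. R (G s)) s0 n"

text \<open>
  \<open>G s y\<close> is the cumulative loss of \<open>y\<close>, weighted by the probabilities with which \<open>s\<close> was played. Both
  base algorithms depend on the past only through it.
\<close>

definition swap_state :: "(('a \<Rightarrow> real) \<Rightarrow> 'a pmf) \<Rightarrow> 'a \<Rightarrow> nat \<Rightarrow> ('a \<Rightarrow> real) list \<Rightarrow> 'a \<Rightarrow> 'a \<Rightarrow> real" where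
  "swap_state R s0 n h = foldl (\<lambda>G f s y. G s y + pmf (swap_dist R s0 n G) s * f y) (\<lambda>s y. 0) h"

definition swap_learner :: "(('a \<Rightarrow> real) \<Rightarrow> 'a pmf) \<Rightarrow> 'a \<Rightarrow> nat \<Rightarrow> ('a \<Rightarrow> real) list \<Rightarrow> 'a pmf" where
  "swap_learner R s0 n h = swap_dist R s0 n (swap_state R s0 n h)"

lemma swap_state_eq:
  "swap_state R s0 n (map f [1..<t]) s y =
    (\<Sum>\<tau>=1..<t. pmf (swap_learner R s0 n (map f [1..<\<tau>])) s * f \<tau> y)"
proof (induction t)
  case 0
  then show ?case by (simp add: swap_state_def)
next
  case (Suc t)
  show ?case
  proof (cases "t = 0")
    case True
    then show ?thesis by (simp add: swap_state_def)
  next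
    case False
    then have "[1..<Suc t] = [1..<t] @ [t]" by simp
    then have "swap_state R s0 n (map f [1..<Suc t]) s y =
        swap_state R s0 n (map f [1..<t]) s y + pmf (swap_learner R s0 n (map f [1..<t])) s * f t y"
      by (simp add: swap_state_def swap_learner_def)
    then show ?thesis using Suc False by (simp add: sum.atLeastLessThan_Suc)
  qed
qed

text \<open>Play is supported in \<open>S\<close>, so an arbitrary \<open>\<phi>\<close> acts only
  through its values on \<open>S\<close>, and the copy owned by \<open>s\<close> competes with the
  fixed point \<open>\<phi> s\<close>. The base bound has two parts because the weights of all
  copies sum to 1 in each round: \<open>\<rho>\<close> is paid \<open>card S\<close> times,
  \<open>\<kappa>\<close> only \<open>T\<close> times. The fed losses agree with members of
  \<open>Ls\<close> on \<open>K\<close> alone, since the learner sees them cut off to 0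
  outside.\<close>

lemma swap_regret_reduction:
  fixes K :: "'a set" and R :: "('a \<Rightarrow> real) \<Rightarrow> 'a pmf" and L \<rho> \<kappa> :: real
  assumes S: "finite S" "S \<subseteq> K" "s0 \<in> S" and n: "n \<ge> (1::nat)"
    and R: "\<And>g. set_pmf (R g) \<subseteq> S"
    and range: "\<And>l x y. l \<in> Ls \<Longrightarrow> x \<in> K \<Longrightarrow> y \<in> K \<Longrightarrow> \<bar>l x - l y\<bar> \<le> L"
    and reg: "\<And>f w y. (\<And>t. t \<in> {1..T} \<Longrightarrow> \<exists>l\<in>Ls. \<forall>x\<in>K. f t x = l x) \<Longrightarrow>
      (\<And>t. 0 \<le> w t \<and> w t \<le> 1) \<Longrightarrow> y \<in> K \<Longrightarrow>
      (\<Sum>t=1..T. w t * (measure_pmf.expectation (R (\<lambda>x. \<Sum>\<tau>=1..<t. w \<tau> * f \<tau> x)) (f t) - f t y))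
        \<le> \<rho> + \<kappa> * (\<Sum>t=1..T. w t)"
  shows "achieves K Ls T (card S * \<rho> + \<kappa> * T + L * T / n)"
  unfolding achieves_def
proof (intro exI conjI allI impI)
  let ?A = "swap_learner R s0 n"
  have AS: "set_pmf (?A h) \<subseteq> S" for h
    unfolding swap_learner_def swap_dist_def by (rule set_cesaro_pmf) (use n S R in auto)
  show "valid_learner K ?A"
    unfolding valid_learner_def using AS S by (meson finite_subset subset_trans)
  fix l assume l: "\<forall>t\<in>{1..T}. l t \<in> Ls"
  define f where "f t x = (if x \<in> K then l t x else 0)" for t x
  define p where "p t = ?A (map f [1..<t])" for t
  define G where "G t s = (\<lambda>x. \<Sum>\<tau>=1..<t. pmf (p \<tau>) s * f \<tau> x)" for t s
  have pS: "set_pmf (p t) \<subseteq> S" for t unfolding p_def by (rule AS)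
  have play: "play K ?A l t = p t" for t unfolding play_def p_def f_def ..
  have p_eq: "p t = cesaro_pmf (\<lambda>s. R (G t s)) s0 n" for t
  proof -
    have "swap_state R s0 n (map f [1..<t]) s = G t s" for s
      unfolding G_def p_def by (rule ext) (rule swap_state_eq)
    then show ?thesis by (simp only: p_def swap_learner_def swap_dist_def)
  qed
  have ffix: "\<exists>l\<in>Ls. \<forall>x\<in>K. f t x = l x" if "t \<in> {1..T}" for t
    using l that unfolding f_def by auto
  show "full_swap_reg K (play K ?A l) l T \<le> card S * \<rho> + \<kappa> * T + L * T / n"
    unfolding full_swap_reg_def play
  proof (rule cSUP_least)
    show "{\<phi>. \<forall>s\<in>K. \<phi> s \<in> K} \<noteq> {}" by (auto intro: exI[of _ id])
    fix \<phi> assume "\<phi> \<in> {\<phi>. \<forall>s\<in>K. \<phi> s \<in> K}"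
    then have \<phi>: "\<phi> s \<in> K" if "s \<in> S" for s using that S by auto
    \<comment> \<open>Almost stationarity replaces the loss of the play by the loss of the
      recommendation of a random \<open>s\<close>, at the price \<open>L / n\<close> per
      round.\<close>
    have round: "measure_pmf.expectation (p t) (l t) - measure_pmf.expectation (p t) (\<lambda>s. l t (\<phi> s))
        \<le> (\<Sum>s\<in>S. pmf (p t) s * (measure_pmf.expectation (R (G t s)) (f t) - f t (\<phi> s))) + L / n"
      if t: "t \<in> {1..T}" for t
    proof -
      have "measure_pmf.expectation (p t) (l t) = measure_pmf.expectation (p t) (f t)"
        unfolding expectation_finite_pmf[OF S(1) pS]
        by (rule sum.cong) (use S in \<open>auto simp: f_def\<close>)
      also have "\<dots> \<le> (\<Sum>s\<in>S. pmf (p t) s * measure_pmf.expectation (R (G t s)) (f t)) + L / n"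
        unfolding p_eq
        by (rule cesaro_pmf_almost_stationary[OF n S(1,3) R])
          (use range[of "l t"] l t S in \<open>auto simp: f_def\<close>)
      finally have 1: "measure_pmf.expectation (p t) (l t) \<le> (\<Sum>s\<in>S. pmf (p t) s * measure_pmf.expectation (R (G t s)) (f t)) + L / n" .
      have 2: "measure_pmf.expectation (p t) (\<lambda>s. l t (\<phi> s)) = (\<Sum>s\<in>S. pmf (p t) s * f t (\<phi> s))"
        unfolding expectation_finite_pmf[OF S(1) pS]
        by (rule sum.cong) (use \<phi> in \<open>auto simp: f_def\<close>)
      show ?thesis using 1 unfolding 2 by (simp add: right_diff_distrib sum_subtractf)
    qed
    have "(\<Sum>t=1..T. measure_pmf.expectation (p t) (l t) - measure_pmf.expectation (p t) (\<lambda>s. l t (\<phi> s)))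
        \<le> (\<Sum>t=1..T. (\<Sum>s\<in>S. pmf (p t) s * (measure_pmf.expectation (R (G t s)) (f t) - f t (\<phi> s))) + L / n)"
      by (rule sum_mono) (rule round)
    also have "\<dots> = (\<Sum>s\<in>S. \<Sum>t=1..T. pmf (p t) s * (measure_pmf.expectation (R (G t s)) (f t) - f t (\<phi> s))) + L * T / n"
      by (subst sum.swap) (simp add: sum.distrib)
    also have "(\<Sum>s\<in>S. \<Sum>t=1..T. pmf (p t) s * (measure_pmf.expectation (R (G t s)) (f t) - f t (\<phi> s)))
        \<le> (\<Sum>s\<in>S. \<rho> + \<kappa> * (\<Sum>t=1..T. pmf (p t) s))"
    proof (rule sum_mono)
      fix s assume s: "s \<in> S"
      show "(\<Sum>t=1..T. pmf (p t) s * (measure_pmf.expectation (R (G t s)) (f t) - f t (\<phi> s)))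
        \<le> \<rho> + \<kappa> * (\<Sum>t=1..T. pmf (p t) s)"
        unfolding G_def by (rule reg) (use ffix \<phi>[OF s] in \<open>auto simp: pmf_le_1\<close>)
    qed
    also have "\<dots> = card S * \<rho> + \<kappa> * (\<Sum>t=1..T. \<Sum>s\<in>S. pmf (p t) s)"
      by (subst sum.swap) (simp add: sum.distrib sum_distrib_left)
    also have "(\<Sum>t=1..T. \<Sum>s\<in>S. pmf (p t) s) = (\<Sum>t=1..T. 1)"
      by (rule sum.cong) (auto intro: sum_pmf_eq_1[OF S(1) pS])
    finally show "(\<Sum>t=1..T. measure_pmf.expectation (p t) (l t) - measure_pmf.expectation (p t) (\<lambda>s. l t (\<phi> s)))
        \<le> card S * \<rho> + \<kappa> * T + L * T / n" by simp
  qed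
qed

subsection \<open>Hedge\<close>

definition hedge :: "'a set \<Rightarrow> real \<Rightarrow> ('a \<Rightarrow> real) \<Rightarrow> 'a pmf" where
  "hedge S \<eta> g = weighted_pmf S (\<lambda>s. exp (- \<eta> * g s) / (\<Sum>s'\<in>S. exp (- \<eta> * g s')))"

lemma
  assumes "finite S" "S \<noteq> {}"
  shows pmf_hedge: "s \<in> S \<Longrightarrow> pmf (hedge S \<eta> g) s = exp (- \<eta> * g s) / (\<Sum>s'\<in>S. exp (- \<eta> * g s'))"
    and set_hedge: "set_pmf (hedge S \<eta> g) \<subseteq> S"
proof -
  let ?u = "\<lambda>s. exp (- \<eta> * g s) / (\<Sum>s'\<in>S. exp (- \<eta> * g s'))"
  have Z: "(\<Sum>s'\<in>S. exp (- \<eta> * g s')) > 0" using assms by (intro sum_pos) auto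
  have 1: "\<And>s. s \<in> S \<Longrightarrow> ?u s \<ge> 0" using Z by simp
  have 2: "sum ?u S = 1" using Z unfolding sum_divide_distrib[symmetric] by simp
  show "s \<in> S \<Longrightarrow> pmf (hedge S \<eta> g) s = ?u s"
    unfolding hedge_def using pmf_weighted_pmf[OF assms(1) 1 2] by simp
  show "set_pmf (hedge S \<eta> g) \<subseteq> S"
    unfolding hedge_def by (rule set_weighted_pmf[OF assms(1) 1 2])
qed

lemma exp_moment_bound:
  fixes h :: "'a \<Rightarrow> real"
  assumes S: "finite S" "set_pmf p \<subseteq> S" and h: "\<And>x y. x \<in> S \<Longrightarrow> y \<in> S \<Longrightarrow> \<bar>h x - h y\<bar> \<le> r" and \<eta>: "\<eta> > 0"
  shows "(\<Sum>s\<in>S. pmf p s * exp (- \<eta> * h s)) \<le> exp (- \<eta> * measure_pmf.expectation p h + \<eta>\<^sup>2 * r\<^sup>2 / 2)"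
proof -
  obtain x0 where x0: "x0 \<in> S" using S(2) set_pmf_not_empty[of p] by blast
  define f where "f x = - h x" for x
  have fin: "finite (set_pmf p)" using S finite_subset by blast
  \<comment> \<open>Oscillation \<open>r\<close> places \<open>f\<close> within \<open>r\<close> of
    its value at \<open>x0\<close>. This interval has length \<open>2 * r\<close>, so the 1/8 in
    Hoeffding's lemma becomes 1/2.\<close>
  interpret interval_bounded_random_variable "measure_pmf p" f "f x0 - r" "f x0 + r"
  proof
    show "AE x in measure_pmf p. f x \<in> {f x0 - r..f x0 + r}"
      using h[OF x0] S(2) by (force simp: AE_measure_pmf_iff f_def abs_le_iff)
  qed simp
  have "ennreal (measure_pmf.expectation p (\<lambda>x. exp (\<eta> * (f x - measure_pmf.expectation p f))))
      = nn_integral (measure_pmf p) (\<lambda>x. exp (\<eta> * (f x - measure_pmf.expectation p f)))"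
    by (rule nn_integral_eq_integral[symmetric]) (auto intro: integrable_measure_pmf_finite[OF fin])
  also have "\<dots> \<le> ennreal (exp (\<eta>\<^sup>2 * ((f x0 + r - measure_pmf.expectation p f) - (f x0 - r - measure_pmf.expectation p f))\<^sup>2 / 8))"
    using Hoeffdings_lemma_nn_integral[OF \<eta>] by simp
  also have "\<eta>\<^sup>2 * ((f x0 + r - measure_pmf.expectation p f) - (f x0 - r - measure_pmf.expectation p f))\<^sup>2 / 8 = \<eta>\<^sup>2 * r\<^sup>2 / 2"
    by (simp add: power2_eq_square algebra_simps)
  finally have "measure_pmf.expectation p (\<lambda>x. exp (\<eta> * (f x - measure_pmf.expectation p f))) \<le> exp (\<eta>\<^sup>2 * r\<^sup>2 / 2)"
    by (simp add: ennreal_le_iff)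
  moreover have "measure_pmf.expectation p (\<lambda>x. exp (\<eta> * (f x - measure_pmf.expectation p f)))
      = (\<Sum>s\<in>S. pmf p s * exp (- \<eta> * h s)) * exp (\<eta> * measure_pmf.expectation p h)"
    unfolding expectation_finite_pmf[OF S, of "\<lambda>x. exp (\<eta> * (f x - measure_pmf.expectation p f))"] sum_distrib_right
    by (rule sum.cong) (auto simp: f_def[abs_def] exp_add[symmetric] algebra_simps)
  ultimately have "(\<Sum>s\<in>S. pmf p s * exp (- \<eta> * h s)) * exp (\<eta> * measure_pmf.expectation p h)
      * exp (- \<eta> * measure_pmf.expectation p h) \<le> exp (\<eta>\<^sup>2 * r\<^sup>2 / 2) * exp (- \<eta> * measure_pmf.expectation p h)"
    by (intro mult_right_mono) auto
  then show ?thesis unfolding mult.assoc exp_add[symmetric] by (simp add: algebra_simps)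
qed

text \<open>Potential argument on the partition function \<open>Z\<close>: each round multiplies it
  by an exponential moment controlled by the expected loss, and at the end it still dominates the
  single term of \<open>s\<close>.\<close>

lemma hedge_regret:
  fixes f :: "nat \<Rightarrow> 'a \<Rightarrow> real"
  assumes S: "finite S" "s \<in> S" and \<eta>: "\<eta> > 0"
    and range: "\<And>t x y. t \<in> {1..T} \<Longrightarrow> x \<in> S \<Longrightarrow> y \<in> S \<Longrightarrow> \<bar>f t x - f t y\<bar> \<le> L"
    and w: "\<And>t. 0 \<le> w t \<and> w t \<le> 1"
  shows "(\<Sum>t=1..T. w t * (measure_pmf.expectation (hedge S \<eta> (\<lambda>x. \<Sum>\<tau>=1..<t. w \<tau> * f \<tau> x)) (f t) - f t s))
    \<le> ln (card S) / \<eta> + \<eta> * L\<^sup>2 / 2 * (\<Sum>t=1..T. w t)"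
proof -
  define G where "G t = (\<lambda>x. \<Sum>\<tau>=1..<t. w \<tau> * f \<tau> x)" for t
  define E where "E t = measure_pmf.expectation (hedge S \<eta> (G t)) (f t)" for t
  define Z where "Z t = (\<Sum>s\<in>S. exp (- \<eta> * G t s))" for t
  have Sne: "S \<noteq> {}" using S by auto
  have Zpos: "Z t > 0" for t unfolding Z_def using S Sne by (intro sum_pos) auto
  have bound: "Z (m + 1) \<le> card S * exp (\<Sum>t=1..m. - \<eta> * w t * E t + \<eta>\<^sup>2 * L\<^sup>2 / 2 * w t)"
    if "m \<le> T" for m using that
  proof (induction m)
    case 0
    then show ?case by (simp add: Z_def G_def)
  next
    case (Suc m)
    let ?t = "Suc m"
    let ?p = "hedge S \<eta> (G ?t)"
    have pS: "set_pmf ?p \<subseteq> S" by (rule set_hedge[OF S(1) Sne])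
    have "Z (?t + 1) = Z ?t * (\<Sum>s\<in>S. pmf ?p s * exp (- \<eta> * (w ?t * f ?t s)))"
    proof -
      have "exp (- \<eta> * G (?t + 1) s) = Z ?t * (pmf ?p s * exp (- \<eta> * (w ?t * f ?t s)))" if "s \<in> S" for s
        using Zpos[of ?t] unfolding pmf_hedge[OF S(1) Sne that] Z_def[symmetric]
        by (simp add: G_def exp_add[symmetric] algebra_simps)
      then show ?thesis unfolding Z_def[of "?t + 1"] sum_distrib_left by (intro sum.cong) auto
    qed
    also have "\<dots> \<le> Z ?t * exp (- \<eta> * measure_pmf.expectation ?p (\<lambda>s. w ?t * f ?t s) + \<eta>\<^sup>2 * (w ?t * L)\<^sup>2 / 2)"
    proof (intro mult_left_mono exp_moment_bound[OF S(1) pS _ \<eta>])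
      fix x y assume "x \<in> S" "y \<in> S"
      then have "w ?t * \<bar>f ?t x - f ?t y\<bar> \<le> w ?t * L"
        using w[of ?t] range[of ?t x y] Suc.prems by (intro mult_left_mono) auto
      then show "\<bar>w ?t * f ?t x - w ?t * f ?t y\<bar> \<le> w ?t * L"
        using w[of ?t] by (simp add: right_diff_distrib[symmetric] abs_mult)
    qed (use Zpos[of ?t] in simp)
    also have "\<dots> \<le> Z ?t * exp (- \<eta> * w ?t * E ?t + \<eta>\<^sup>2 * L\<^sup>2 / 2 * w ?t)"
    proof -
      \<comment> \<open>Weights in [0,1] turn the quadratic term into one linear in
        \<open>w\<close>, the form that the swap reduction takes.\<close>
      have "(w ?t)\<^sup>2 \<le> w ?t" using w[of ?t] mult_left_mono[of "w ?t" 1 "w ?t"] by (simp add: power2_eq_square)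
      then have "\<eta>\<^sup>2 * L\<^sup>2 / 2 * (w ?t)\<^sup>2 \<le> \<eta>\<^sup>2 * L\<^sup>2 / 2 * w ?t" by (intro mult_left_mono) auto
      then show ?thesis using Zpos[of ?t] by (simp add: E_def power_mult_distrib mult_ac)
    qed
    also have "\<dots> \<le> card S * exp (\<Sum>t=1..m. - \<eta> * w t * E t + \<eta>\<^sup>2 * L\<^sup>2 / 2 * w t)
        * exp (- \<eta> * w ?t * E ?t + \<eta>\<^sup>2 * L\<^sup>2 / 2 * w ?t)"
      using Suc by (intro mult_right_mono) auto
    also have "\<dots> = card S * exp (\<Sum>t=1..?t. - \<eta> * w t * E t + \<eta>\<^sup>2 * L\<^sup>2 / 2 * w t)"
      by (simp add: exp_add[symmetric] mult.assoc)
    finally show ?case .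
  qed
  have cS: "real (card S) > 0" using S Sne by (simp add: card_gt_0_iff)
  have "exp (- \<eta> * G (T + 1) s) \<le> Z (T + 1)"
    unfolding Z_def by (rule member_le_sum) (use S in auto)
  also note bound[OF order_refl]
  finally have "exp (- \<eta> * G (T + 1) s) \<le> card S * exp (\<Sum>t=1..T. - \<eta> * w t * E t + \<eta>\<^sup>2 * L\<^sup>2 / 2 * w t)" .
  then have "- \<eta> * G (T + 1) s \<le> ln (card S * exp (\<Sum>t=1..T. - \<eta> * w t * E t + \<eta>\<^sup>2 * L\<^sup>2 / 2 * w t))"
    using cS by (subst ln_ge_iff) auto
  also have "\<dots> = ln (card S) + (\<Sum>t=1..T. - \<eta> * w t * E t + \<eta>\<^sup>2 * L\<^sup>2 / 2 * w t)"
    using cS by (subst ln_mult) auto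
  also have "\<dots> = ln (card S) - \<eta> * (\<Sum>t=1..T. w t * E t) + \<eta>\<^sup>2 * L\<^sup>2 / 2 * (\<Sum>t=1..T. w t)"
    by (simp add: sum.distrib sum_subtractf sum_distrib_left sum_negf mult.assoc sum_divide_distrib)
  finally have "\<eta> * ((\<Sum>t=1..T. w t * E t) - G (T + 1) s) \<le> ln (card S) + \<eta>\<^sup>2 * L\<^sup>2 / 2 * (\<Sum>t=1..T. w t)"
    by (simp add: algebra_simps)
  then have "(\<Sum>t=1..T. w t * E t) - G (T + 1) s \<le> (ln (card S) + \<eta>\<^sup>2 * L\<^sup>2 / 2 * (\<Sum>t=1..T. w t)) / \<eta>"
    using \<eta> by (simp add: field_simps)
  also have "\<dots> = ln (card S) / \<eta> + \<eta> * L\<^sup>2 / 2 * (\<Sum>t=1..T. w t)"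
    using \<eta> by (simp add: add_divide_distrib power2_eq_square)
  finally have "(\<Sum>t=1..T. w t * E t) - G (T + 1) s \<le> ln (card S) / \<eta> + \<eta> * L\<^sup>2 / 2 * (\<Sum>t=1..T. w t)" .
  moreover have "(\<Sum>t=1..T. w t * (E t - f t s)) = (\<Sum>t=1..T. w t * E t) - G (T + 1) s"
    by (simp add: G_def right_diff_distrib sum_subtractf atLeastLessThanSuc_atLeastAtMost)
  ultimately show ?thesis unfolding E_def G_def by simp
qed

lemma achieves_mono: "achieves K Ls T B \<Longrightarrow> B \<le> B' \<Longrightarrow> achieves K Ls T B'"
  unfolding achieves_def by (meson order_trans)

text \<open>Rounding is applied to the comparator: a bound against every point of \<open>S\<close>
  averages to one against every mixture, and \<open>e\<close> pays for replacing \<open>y\<close> by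
  its mixture. That mixture is chosen before the losses, as one comparator has to serve all
  rounds.\<close>

lemma hedge_achieves:
  fixes K :: "'a set" and L e \<eta> :: real
  assumes S: "finite S" "S \<subseteq> K" "S \<noteq> {}"
    and range: "\<And>l x y. l \<in> Ls \<Longrightarrow> x \<in> K \<Longrightarrow> y \<in> K \<Longrightarrow> \<bar>l x - l y\<bar> \<le> L"
    and rounding: "\<And>y. y \<in> K \<Longrightarrow> \<exists>q. set_pmf q \<subseteq> S \<and> (\<forall>l\<in>Ls. measure_pmf.expectation q l \<le> l y + e)"
    and \<eta>: "\<eta> > 0" and T: "T \<ge> 1"
  shows "achieves K Ls T (card S * (ln (card S) / \<eta>) + (\<eta> * L\<^sup>2 / 2 + e) * T + L)"
proof -
  obtain s0 where s0: "s0 \<in> S" using S by blast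
  \<comment> \<open>With \<open>T\<close> averaging steps the total stationarity defect is
    \<open>L\<close>.\<close>
  have "achieves K Ls T (card S * (ln (card S) / \<eta>) + (\<eta> * L\<^sup>2 / 2 + e) * T + L * T / T)"
  proof (rule swap_regret_reduction[where R = "hedge S \<eta>", OF S(1,2) s0 T set_hedge[OF S(1,3)] range])
    fix f :: "nat \<Rightarrow> 'a \<Rightarrow> real" and w :: "nat \<Rightarrow> real" and y
    assume f: "\<And>t. t \<in> {1..T} \<Longrightarrow> \<exists>l\<in>Ls. \<forall>x\<in>K. f t x = l x"
      and w: "\<And>t. 0 \<le> w t \<and> w t \<le> (1::real)" and y: "y \<in> K"
    define E where "E t = measure_pmf.expectation (hedge S \<eta> (\<lambda>x. \<Sum>\<tau>=1..<t. w \<tau> * f \<tau> x)) (f t)" for t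
    define B where "B = ln (card S) / \<eta> + \<eta> * L\<^sup>2 / 2 * (\<Sum>t=1..T. w t)"
    obtain q where q: "set_pmf q \<subseteq> S" "\<And>l. l \<in> Ls \<Longrightarrow> measure_pmf.expectation q l \<le> l y + e"
      using rounding[OF y] by blast
    have rf: "\<bar>f t x - f t z\<bar> \<le> L" if "t \<in> {1..T}" "x \<in> S" "z \<in> S" for t x z
    proof -
      from f[OF that(1)] obtain l where l: "l \<in> Ls" "\<forall>x\<in>K. f t x = l x" by blast
      have "x \<in> K" "z \<in> K" using that S(2) by auto
      then show ?thesis using range[OF l(1), of x z] l(2) by simp
    qed
    have B: "(\<Sum>t=1..T. w t * (E t - f t s)) \<le> B" if "s \<in> S" for s
      unfolding E_def B_def by (rule hedge_regret[OF S(1) that \<eta> rf w])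
    have qf: "measure_pmf.expectation q (f t) \<le> f t y + e" if t: "t \<in> {1..T}" for t
    proof -
      obtain l where l: "l \<in> Ls" "\<forall>x\<in>K. f t x = l x" using f[OF t] by blast
      have "measure_pmf.expectation q (f t) = measure_pmf.expectation q l"
        unfolding expectation_finite_pmf[OF S(1) q(1)] by (rule sum.cong) (use l S in auto)
      then show ?thesis using q(2)[OF l(1)] l(2) y by simp
    qed
    have "(\<Sum>t=1..T. w t * (E t - f t y)) \<le> (\<Sum>t=1..T. w t * (E t - measure_pmf.expectation q (f t)) + e * w t)"
    proof (rule sum_mono)
      fix t assume t: "t \<in> {1..T}"
      have "w t * measure_pmf.expectation q (f t) \<le> w t * (f t y + e)"
        using qf[OF t] w[of t] by (intro mult_left_mono) auto
      then show "w t * (E t - f t y) \<le> w t * (E t - measure_pmf.expectation q (f t)) + e * w t"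
        by (simp add: algebra_simps)
    qed
    also have "\<dots> = (\<Sum>t=1..T. w t * (E t - measure_pmf.expectation q (f t))) + e * (\<Sum>t=1..T. w t)"
      by (simp add: sum.distrib sum_distrib_left)
    also have "(\<Sum>t=1..T. w t * (E t - measure_pmf.expectation q (f t))) =
        (\<Sum>t=1..T. w t * (\<Sum>s\<in>S. pmf q s * (E t - f t s)))"
      by (rule sum.cong) (simp_all add: expectation_finite_pmf[OF S(1) q(1)] right_diff_distrib sum_subtractf
          sum_distrib_right[symmetric] sum_pmf_eq_1[OF S(1) q(1)])
    also have "\<dots> = (\<Sum>s\<in>S. pmf q s * (\<Sum>t=1..T. w t * (E t - f t s)))"
      unfolding sum_distrib_left by (subst sum.swap) (simp add: mult_ac)
    also have "\<dots> \<le> (\<Sum>s\<in>S. pmf q s * B)"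
      by (intro sum_mono mult_left_mono B) auto
    also have "\<dots> = B" by (simp add: sum_distrib_right[symmetric] sum_pmf_eq_1[OF S(1) q(1)])
    finally show "(\<Sum>t=1..T. w t * (measure_pmf.expectation (hedge S \<eta> (\<lambda>x. \<Sum>\<tau>=1..<t. w \<tau> * f \<tau> x)) (f t) - f t y))
        \<le> ln (card S) / \<eta> + (\<eta> * L\<^sup>2 / 2 + e) * (\<Sum>t=1..T. w t)"
      unfolding E_def B_def by (simp add: algebra_simps)
  qed
  then show ?thesis using T by simp
qed

lemma half_le_ln:
  assumes "T \<ge> (2::nat)"
  shows "1/2 \<le> ln (real T)"
proof -
  have "1/2 \<le> ln (2::real)" using ln2_ge_two_thirds by simp
  also have "\<dots> \<le> ln T" using assms by simp
  finally show ?thesis .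
qed

text \<open>The choice of \<open>\<eta>\<close> balances the two Hedge terms at order
  \<open>L * sqrt (M * T)\<close>, where \<open>M\<close> is about \<open>T powr \<kappa>\<close> up
  to a logarithm; hence the exponent \<open>(1 + \<kappa>) / 2\<close>.\<close>

lemma hedge_rate:
  fixes K :: "'a set" and C L e \<kappa> :: real
  assumes S: "finite S" "S \<subseteq> K" "S \<noteq> {}" and card: "card S \<le> C * T powr \<kappa>"
    and C: "C \<ge> 2" and \<kappa>: "0 \<le> \<kappa>" "\<kappa> \<le> 1" and L: "L > 0"
    and range: "\<And>l x y. l \<in> Ls \<Longrightarrow> x \<in> K \<Longrightarrow> y \<in> K \<Longrightarrow> \<bar>l x - l y\<bar> \<le> L"
    and rounding: "\<And>y. y \<in> K \<Longrightarrow> \<exists>q. set_pmf q \<subseteq> S \<and> (\<forall>l\<in>Ls. measure_pmf.expectation q l \<le> l y + e)"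
    and T: "T \<ge> 2"
  shows "achieves K Ls T (e * T + 7 * C * L * T powr ((1 + \<kappa>) / 2) * ln T)"
proof -
  define N where "N = C * T powr \<kappa>"
  have Tr: "real T \<ge> 2" using T by simp
  have lnT: "1/2 \<le> ln T" using half_le_ln[OF T] .
  have "1 \<le> T powr \<kappa>" using Tr \<kappa> by (simp add: ge_one_powr_ge_zero)
  then have N: "N \<ge> 2" unfolding N_def using C mult_mono[of 2 C 1 "T powr \<kappa>"] by simp
  have cS: "1 \<le> real (card S)" using S by (simp add: Suc_leI card_gt_0_iff)
  \<comment> \<open>Built from the bound \<open>N \<ge> 2\<close> and not from
    \<open>card S\<close>, so that \<open>\<eta>\<close> stays positive when \<open>S\<close> is a
    singleton and \<open>ln (card S)\<close> vanishes.\<close>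
  define M where "M = N * ln N"
  have M: "M > 0" unfolding M_def using N by simp
  define \<eta> where "\<eta> = sqrt (M / T) / L"
  have \<eta>: "\<eta> > 0" unfolding \<eta>_def using M L T by simp
  have Mle: "M \<le> (2 * C)\<^sup>2 * (T powr \<kappa> * ln T)"
  proof -
    have "ln N = ln C + \<kappa> * ln T" unfolding N_def using C T by (simp add: ln_mult ln_powr)
    also have "\<dots> \<le> ln C * (2 * ln T) + 1 * ln T"
      using lnT C \<kappa> mult_left_mono[of 1 "2 * ln T" "ln C"] by (intro add_mono mult_right_mono) auto
    also have "\<dots> = (2 * ln C + 1) * ln T" by (simp add: algebra_simps)
    also have "\<dots> \<le> (4 * C) * ln T"
      using lnT ln_le_minus_one[of C] C by (intro mult_right_mono) auto
    finally have "ln N \<le> 4 * C * ln T" .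
    then have "M \<le> N * (4 * C * ln T)" unfolding M_def using N by (intro mult_left_mono) auto
    also have "\<dots> = (2 * C)\<^sup>2 * (T powr \<kappa> * ln T)" by (simp add: N_def power2_eq_square)
    finally show ?thesis .
  qed
  \<comment> \<open>The root leaves only \<open>sqrt (ln T)\<close>, which is rounded up to
    \<open>2 * ln T\<close> by \<open>ln T \<ge> 1/2\<close>.\<close>
  have root: "sqrt (M * T) \<le> 4 * C * (T powr ((1 + \<kappa>) / 2) * ln T)"
  proof -
    have P: "T powr \<kappa> * T = (T powr ((1 + \<kappa>) / 2))\<^sup>2"
      using T by (simp add: power2_eq_square powr_add[symmetric] powr_add)
    have "ln T \<le> ln T * (2 * ln T)" using lnT mult_left_mono[of 1 "2 * ln T" "ln T"] by simp
    then have "ln T \<le> 2 * (ln T)\<^sup>2" by (simp add: power2_eq_square)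
    then have "ln T \<le> 4 * (ln T)\<^sup>2" using zero_le_power2[of "ln T"] by linarith
    then have l: "ln T \<le> (2 * ln T)\<^sup>2" by (simp add: power_mult_distrib)
    have "M * T \<le> (2 * C)\<^sup>2 * (T powr \<kappa> * ln T) * T" using Mle by (intro mult_right_mono) auto
    also have "\<dots> = (2 * C)\<^sup>2 * (T powr ((1 + \<kappa>) / 2))\<^sup>2 * ln T" unfolding P[symmetric] by simp
    also have "\<dots> \<le> (2 * C)\<^sup>2 * (T powr ((1 + \<kappa>) / 2))\<^sup>2 * (2 * ln T)\<^sup>2"
      using l by (intro mult_left_mono) auto
    also have "\<dots> = (4 * C * (T powr ((1 + \<kappa>) / 2) * ln T))\<^sup>2" by (simp add: power_mult_distrib)
    finally show ?thesis using C lnT by (intro real_le_lsqrt) auto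
  qed
  show ?thesis
  proof (rule achieves_mono[OF hedge_achieves[OF S range rounding \<eta>]])
    have "card S * ln (card S) \<le> M"
      unfolding M_def using card cS N by (intro mult_mono) (auto simp: N_def)
    then have "card S * ln (card S) / \<eta> \<le> M / \<eta>" using \<eta> by (simp add: divide_right_mono)
    also have "M / \<eta> = L * sqrt (M * T)"
      using M L T by (simp add: \<eta>_def real_sqrt_divide real_sqrt_mult field_simps)
    finally have 1: "card S * ln (card S) / \<eta> \<le> L * sqrt (M * T)" .
    have "sqrt (M / T) * T = sqrt (M * T)"
      using T by (simp add: real_sqrt_divide real_sqrt_mult real_div_sqrt field_simps)
    then have 2: "\<eta> * L\<^sup>2 * T = L * sqrt (M * T)"
      using L by (simp add: \<eta>_def power2_eq_square)
    have "1 \<le> T powr ((1 + \<kappa>) / 2)" using Tr \<kappa> by (simp add: ge_one_powr_ge_zero)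
    then have "1 * (1/2) \<le> T powr ((1 + \<kappa>) / 2) * ln T" using lnT by (intro mult_mono) auto
    then have "1 * 1 \<le> C * (T powr ((1 + \<kappa>) / 2) * ln T)"
      using mult_mono[of 2 C "1/2" "T powr ((1 + \<kappa>) / 2) * ln T"] C by simp
    then have 3: "L \<le> L * (C * (T powr ((1 + \<kappa>) / 2) * ln T))" using L by simp
    have 4: "L * sqrt (M * T) \<le> L * (4 * C * (T powr ((1 + \<kappa>) / 2) * ln T))"
      using root L by (intro mult_left_mono) auto
    have "card S * (ln (card S) / \<eta>) + (\<eta> * L\<^sup>2 / 2 + e) * T + L
        = card S * ln (card S) / \<eta> + \<eta> * L\<^sup>2 * T / 2 + e * T + L" by (simp add: algebra_simps)
    \<comment> \<open>7 = 4 + 2 + 1: the first Hedge term, the halved second one, and the defect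
      \<open>L\<close>.\<close>
    also have "\<dots> \<le> e * T + 7 * (L * (C * (T powr ((1 + \<kappa>) / 2) * ln T)))"
      using 1 2 3 4 by simp
    finally show "card S * (ln (card S) / \<eta>) + (\<eta> * L\<^sup>2 / 2 + e) * T + L
        \<le> e * T + 7 * C * L * T powr ((1 + \<kappa>) / 2) * ln T" by (simp add: mult_ac)
  qed (use T in auto)
qed

subsection \<open>Follow the leader\<close>

text \<open>A weighted harmonic sum. With \<open>W\<close> the partial sum, \<open>w \<le> 1\<close>
  and \<open>w \<le> W\<close> give \<open>w * (1 + W) \<le> 2 * W\<close>, so each term is at most
  twice an increment of \<open>ln (1 + W)\<close>. The shift by 1 keeps the logarithm harmless while
  the weights are still 0.\<close>

lemma sum_sq_div_partial_sums_le_ln: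
  fixes w :: "nat \<Rightarrow> real"
  assumes w: "\<And>t. 0 \<le> w t \<and> w t \<le> 1"
  shows "(\<Sum>t=1..T. (w t)\<^sup>2 / (\<Sum>\<tau>=1..t. w \<tau>)) \<le> 2 * ln (1 + (\<Sum>\<tau>=1..T. w \<tau>))"
proof (induction T)
  case (Suc T)
  define V where "V = (\<Sum>\<tau>=1..T. w \<tau>)"
  define W where "W = (\<Sum>\<tau>=1..Suc T. w \<tau>)"
  have W: "W = V + w (Suc T)" by (simp add: V_def W_def)
  have V: "V \<ge> 0" unfolding V_def using w by (intro sum_nonneg) auto
  have "(w (Suc T))\<^sup>2 / W \<le> 2 * (ln (1 + W) - ln (1 + V))"
  proof (cases "W = 0")
    case True
    then have "V = 0" using W V w[of "Suc T"] by simp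
    then show ?thesis using True by simp
  next
    case False
    then have W0: "W > 0" using W V w[of "Suc T"] by simp
    have "w (Suc T) * W \<le> W" using w[of "Suc T"] W0 by (simp add: mult_le_cancel_right1)
    then have "w (Suc T) * (1 + W) \<le> 2 * W" using W V by (simp add: algebra_simps)
    then have "w (Suc T) * (w (Suc T) * (1 + W)) \<le> w (Suc T) * (2 * W)"
      using w[of "Suc T"] by (intro mult_left_mono) auto
    then have "(w (Suc T))\<^sup>2 / W \<le> 2 * (w (Suc T) / (1 + W))"
      using W0 by (simp add: field_simps power2_eq_square)
    also have "w (Suc T) / (1 + W) = 1 - (1 + V) / (1 + W)"
      using W0 W by (simp add: field_simps)
    also have "\<dots> \<le> - ln ((1 + V) / (1 + W))"
      using ln_le_minus_one[of "(1 + V) / (1 + W)"] V W0 by simp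
    also have "\<dots> = ln (1 + W) - ln (1 + V)" using V W0 by (simp add: ln_div)
    finally show ?thesis by simp
  qed
  then show ?case using Suc by (simp add: V_def W_def)
qed simp

definition ftl_point :: "'a set \<Rightarrow> ('a \<Rightarrow> real) \<Rightarrow> 'a" where
  "ftl_point K g = (SOME z. z \<in> K \<and> (\<forall>y\<in>K. g z \<le> g y))"

lemma ftl_point:
  fixes K :: "'a::topological_space set"
  assumes "compact K" "K \<noteq> {}" "continuous_on K g"
  shows "ftl_point K g \<in> K" "y \<in> K \<Longrightarrow> g (ftl_point K g) \<le> g y"
proof -
  have "\<exists>z. z \<in> K \<and> (\<forall>y\<in>K. g z \<le> g y)"
    using continuous_attains_inf[OF assms] by blast
  from someI_ex[OF this] show "ftl_point K g \<in> K" "y \<in> K \<Longrightarrow> g (ftl_point K g) \<le> g y"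
    unfolding ftl_point_def by auto
qed

text \<open>Regret is at most the sum of the gains from looking one round ahead. The objective after
  round \<open>t\<close> is strongly convex with modulus \<open>\<alpha> * W t\<close>, so round
  \<open>t\<close> moves the leader by \<open>O (L * w t / (\<alpha> * W t))\<close>, and the gains
  form a weighted harmonic sum. Strong convexity is assumed in midpoint form, which passes directly
  to weighted sums.\<close>

lemma ftl_regret:
  fixes K :: "'a::euclidean_space set" and f :: "nat \<Rightarrow> 'a \<Rightarrow> real" and L \<alpha> :: real
  assumes K: "compact K" "convex K" "y \<in> K" and \<alpha>: "\<alpha> > 0"
    and lip: "\<And>t. t \<in> {1..T} \<Longrightarrow> L-lipschitz_on K (f t)"
    and mid: "\<And>t x z. t \<in> {1..T} \<Longrightarrow> x \<in> K \<Longrightarrow> z \<in> K \<Longrightarrow>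
      f t (midpoint x z) \<le> (f t x + f t z) / 2 - \<alpha> / 8 * (dist x z)\<^sup>2"
    and w: "\<And>t. 0 \<le> w t \<and> w t \<le> 1"
  shows "(\<Sum>t=1..T. w t * (f t (ftl_point K (\<lambda>x. \<Sum>\<tau>=1..<t. w \<tau> * f \<tau> x)) - f t y))
    \<le> 8 * L\<^sup>2 / \<alpha> * ln (1 + real T)"
proof -
  define F where "F t = (\<lambda>x. \<Sum>\<tau>=1..<t. w \<tau> * f \<tau> x)" for t
  define z where "z t = ftl_point K (F t)" for t
  define W where "W t = (\<Sum>\<tau>=1..t. w \<tau>)" for t
  have Kne: "K \<noteq> {}" using K by auto
  have FSuc: "F (Suc t) x = F t x + w t * f t x" if "t \<ge> 1" for t x
    using that by (simp add: F_def)
  have cont: "continuous_on K (F (Suc t))" if "t \<le> T" for t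
    unfolding F_def using that
    by (intro continuous_intros lipschitz_on_continuous_on[OF lip]) auto
  have zK: "z (Suc t) \<in> K" and zmin: "x \<in> K \<Longrightarrow> F (Suc t) (z (Suc t)) \<le> F (Suc t) x" if "t \<le> T" for t x
    unfolding z_def using ftl_point[OF K(1) Kne cont[OF that]] by auto
  \<comment> \<open>Be the leader: knowing round \<open>t\<close> in advance gives nonpositive
    regret. The induction needs \<open>x\<close> arbitrary, because its hypothesis is used at the
    next leader.\<close>
  have btl: "(\<Sum>t=1..m. w t * f t (z (Suc t))) \<le> F (Suc m) x" if "m \<le> T" "x \<in> K" for m x
    using that
  proof (induction m arbitrary: x)
    case 0
    then show ?case by (simp add: F_def)
  next
    case (Suc m)
    have "(\<Sum>t=1..Suc m. w t * f t (z (Suc t))) \<le> F (Suc m) (z (Suc (Suc m))) + w (Suc m) * f (Suc m) (z (Suc (Suc m)))"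
      using Suc zK[of "Suc m"] by simp
    also have "\<dots> = F (Suc (Suc m)) (z (Suc (Suc m)))" by (simp add: FSuc)
    also have "\<dots> \<le> F (Suc (Suc m)) x" using zmin[of "Suc m"] Suc.prems by simp
    finally show ?case .
  qed
  have midF: "F (Suc t) (midpoint a b) \<le> (F (Suc t) a + F (Suc t) b) / 2 - \<alpha> * W t / 8 * (dist a b)\<^sup>2"
    if t: "t \<le> T" and ab: "a \<in> K" "b \<in> K" for t a b
  proof -
    have "F (Suc t) (midpoint a b) \<le> (\<Sum>\<tau>=1..<Suc t. w \<tau> * ((f \<tau> a + f \<tau> b) / 2 - \<alpha> / 8 * (dist a b)\<^sup>2))"
      unfolding F_def using t ab w by (intro sum_mono mult_left_mono mid) auto
    also have "\<dots> = (\<Sum>\<tau>=1..<Suc t. (w \<tau> * f \<tau> a + w \<tau> * f \<tau> b) / 2 - w \<tau> * (\<alpha> / 8 * (dist a b)\<^sup>2))"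
      by (intro sum.cong) (auto simp: field_simps)
    also have "\<dots> = (F (Suc t) a + F (Suc t) b) / 2 - W t * (\<alpha> / 8 * (dist a b)\<^sup>2)"
      unfolding F_def W_def sum_subtractf sum_distrib_right[symmetric] sum_divide_distrib[symmetric] sum.distrib
        atLeastLessThanSuc_atLeastAtMost ..
    finally show ?thesis by (simp add: mult_ac)
  qed
  have stab: "w t * (f t (z t) - f t (z (Suc t))) \<le> 4 * L\<^sup>2 / \<alpha> * ((w t)\<^sup>2 / W t)" if t: "t \<in> {1..T}" for t
  proof -
    let ?a = "z t" and ?b = "z (Suc t)"
    define d where "d = dist ?a ?b"
    define r where "r = w t * (f t ?a - f t ?b)"
    have t1: "t \<ge> 1" "t \<le> T" using t by auto
    then obtain t' where t': "t = Suc t'" using not0_implies_Suc by force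
    have ab: "?a \<in> K" "?b \<in> K" using zK[of t'] zK[of t] t1 t' by auto
    have "midpoint ?a ?b \<in> K" using ab K(2) midpoint_in_closed_segment convex_contains_segment by blast
    then have "F (Suc t) ?b \<le> F (Suc t) (midpoint ?a ?b)" using zmin[of t] t1 by simp
    also have "\<dots> \<le> (F (Suc t) ?a + F (Suc t) ?b) / 2 - \<alpha> * W t / 8 * d\<^sup>2"
      unfolding d_def by (rule midF[OF t1(2) ab])
    finally have "\<alpha> * W t / 4 * d\<^sup>2 \<le> F (Suc t) ?a - F (Suc t) ?b" by (simp add: field_simps)
    also have "\<dots> = (F t ?a - F t ?b) + r" using t1 by (simp add: FSuc r_def algebra_simps)
    also have "\<dots> \<le> r" using zmin[of t' ?b] t' t1 ab by simp
    finally have 1: "\<alpha> * W t / 4 * d\<^sup>2 \<le> r" .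
    have "\<bar>f t ?a - f t ?b\<bar> \<le> L * d"
      using lipschitz_onD[OF lip[OF t] ab] by (simp add: d_def dist_real_def)
    then have 2: "r \<le> w t * (L * d)" unfolding r_def using w[of t] by (intro mult_left_mono) auto
    have L: "L \<ge> 0" using lipschitz_on_nonneg[OF lip[OF t]] .
    have Wt: "w t \<le> W t" unfolding W_def using t1 w by (intro member_le_sum) auto
    show ?thesis
    \<comment> \<open>If \<open>W t = 0\<close>, then \<open>w t = 0\<close> and the quotient on the
      right is 0 by convention.\<close>
    proof (cases "W t = 0 \<or> r \<le> 0")
      case True
      then have "r \<le> 0" using Wt w[of t] by (auto simp: r_def)
      also have "0 \<le> 4 * L\<^sup>2 / \<alpha> * ((w t)\<^sup>2 / W t)"
        using \<alpha> Wt w[of t] by (intro mult_nonneg_nonneg divide_nonneg_nonneg) auto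
      finally show ?thesis unfolding r_def .
    next
      case False
      then have W0: "W t > 0" and r0: "r > 0" using Wt w[of t] by auto
      \<comment> \<open>Squaring the Lipschitz upper bound on \<open>r\<close> and inserting the
        quadratic lower bound eliminates \<open>d\<close>; one factor \<open>r\<close> then
        cancels.\<close>
      have "r * r \<le> (w t * (L * d)) * (w t * (L * d))" using 2 r0 by (intro mult_mono) auto
      also have "\<dots> = 4 * L\<^sup>2 / \<alpha> * ((w t)\<^sup>2 / W t) * (\<alpha> * W t / 4 * d\<^sup>2)"
        using W0 \<alpha> by (simp add: power2_eq_square)
      also have "\<dots> \<le> 4 * L\<^sup>2 / \<alpha> * ((w t)\<^sup>2 / W t) * r"
        using 1 \<alpha> W0 by (intro mult_left_mono mult_nonneg_nonneg) auto
      finally have "r \<le> 4 * L\<^sup>2 / \<alpha> * ((w t)\<^sup>2 / W t)" using r0 by (rule mult_right_le_imp_le)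
      then show ?thesis unfolding r_def .
    qed
  qed
  have "(\<Sum>t=1..T. w t * (f t (z t) - f t y))
      = (\<Sum>t=1..T. w t * (f t (z t) - f t (z (Suc t)))) + ((\<Sum>t=1..T. w t * f t (z (Suc t))) - F (Suc T) y)"
    unfolding F_def by (simp add: right_diff_distrib sum_subtractf atLeastLessThanSuc_atLeastAtMost)
  also have "\<dots> \<le> (\<Sum>t=1..T. 4 * L\<^sup>2 / \<alpha> * ((w t)\<^sup>2 / W t)) + 0"
    using btl[OF order_refl K(3)] by (intro add_mono sum_mono stab) auto
  also have "\<dots> = 4 * L\<^sup>2 / \<alpha> * (\<Sum>t=1..T. (w t)\<^sup>2 / W t)" by (simp add: sum_distrib_left)
  also have "\<dots> \<le> 4 * L\<^sup>2 / \<alpha> * (2 * ln (1 + W T))"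
    unfolding W_def using \<alpha> by (intro mult_left_mono sum_sq_div_partial_sums_le_ln w) auto
  also have "\<dots> \<le> 4 * L\<^sup>2 / \<alpha> * (2 * ln (1 + real T))"
  proof -
    have "W T \<le> T" unfolding W_def using sum_bounded_above[of "{1..T}" w 1] w by simp
    moreover have "0 \<le> W T" unfolding W_def using w by (intro sum_nonneg) auto
    ultimately have "ln (1 + W T) \<le> ln (1 + real T)" by (subst ln_le_cancel_iff) auto
    then show ?thesis using \<alpha> by (intro mult_left_mono) auto
  qed
  finally show ?thesis unfolding z_def F_def by simp
qed

text \<open>Here it is the recommendation that is rounded, not the comparator: each copy plays the
  distribution on \<open>S\<close> that rounds its leader, which costs \<open>e\<close> per unit of
  weight.\<close>

lemma ftl_achieves:
  fixes K :: "'a::euclidean_space set" and L \<alpha> e :: real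
  assumes S: "finite S" "S \<subseteq> K" "S \<noteq> {}" and K: "compact K" "convex K" and \<alpha>: "\<alpha> > 0"
    and lip: "\<And>l. l \<in> Ls \<Longrightarrow> L-lipschitz_on K l"
    and mid: "\<And>l x z. l \<in> Ls \<Longrightarrow> x \<in> K \<Longrightarrow> z \<in> K \<Longrightarrow>
      l (midpoint x z) \<le> (l x + l z) / 2 - \<alpha> / 8 * (dist x z)\<^sup>2"
    and rounding: "\<And>y. y \<in> K \<Longrightarrow> \<exists>q. set_pmf q \<subseteq> S \<and> (\<forall>l\<in>Ls. measure_pmf.expectation q l \<le> l y + e)"
    and \<rho>: "\<rho> > 0"
  shows "achieves K Ls T (card S * (8 * L\<^sup>2 / \<alpha> * ln (1 + real T)) + e * T + \<rho>)"
proof -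
  obtain s0 where s0: "s0 \<in> S" using S by blast
  have Kne: "K \<noteq> {}" using S by auto
  \<comment> \<open>For a state without a minimizer on \<open>K\<close> the chosen leader may lie
    outside \<open>K\<close>; the default \<open>return_pmf s0\<close> keeps every recommendation
    supported in \<open>S\<close>, as the reduction requires.\<close>
  define q where "q y = (if y \<in> K then SOME q. set_pmf q \<subseteq> S \<and> (\<forall>l\<in>Ls. measure_pmf.expectation q l \<le> l y + e)
    else return_pmf s0)" for y
  have q0: "set_pmf (q y) \<subseteq> S \<and> (\<forall>l\<in>Ls. measure_pmf.expectation (q y) l \<le> l y + e)" if "y \<in> K" for y
    using someI_ex[OF rounding[OF that]] that unfolding q_def by simp
  have qS: "set_pmf (q y) \<subseteq> S" for y
    using q0[of y] s0 by (cases "y \<in> K") (auto simp: q_def)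
  define M where "M = L * diameter K"
  \<comment> \<open>The number of averaging steps is free, so the stationarity defect can be pushed
    below any prescribed \<open>\<rho>\<close>.\<close>
  obtain n where "M * T / \<rho> < real n" using reals_Archimedean2 by blast
  then have n: "M * T / real (Suc n) \<le> \<rho>" using \<rho> by (simp add: field_simps)
  have bK: "bounded K" using K compact_imp_bounded by blast
  show ?thesis
  proof (rule achieves_mono[OF swap_regret_reduction[where R = "\<lambda>g. q (ftl_point K g)" and n = "Suc n" and L = M
        and Ls = Ls and T = T and \<rho> = "8 * L\<^sup>2 / \<alpha> * ln (1 + real T)" and \<kappa> = e, OF S(1,2) s0 _ qS]])
    fix l x y assume l: "l \<in> Ls" and xy: "x \<in> K" "y \<in> K"
    have "\<bar>l x - l y\<bar> \<le> L * dist x y" using lipschitz_onD[OF lip[OF l] xy] by (simp add: dist_real_def)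
    also have "\<dots> \<le> M"
      unfolding M_def using diameter_bounded_bound[OF bK xy] lipschitz_on_nonneg[OF lip[OF l]]
      by (intro mult_left_mono) auto
    finally show "\<bar>l x - l y\<bar> \<le> M" .
  next
    fix f :: "nat \<Rightarrow> 'a \<Rightarrow> real" and w :: "nat \<Rightarrow> real" and y
    assume f: "\<And>t. t \<in> {1..T} \<Longrightarrow> \<exists>l\<in>Ls. \<forall>x\<in>K. f t x = l x"
      and w: "\<And>t. 0 \<le> w t \<and> w t \<le> (1::real)" and y: "y \<in> K"
    define z where "z t = ftl_point K (\<lambda>x. \<Sum>\<tau>=1..<t. w \<tau> * f \<tau> x)" for t
    have lf: "L-lipschitz_on K (f t)" if "t \<in> {1..T}" for t
    proof -
      from f[OF that] obtain l where l: "l \<in> Ls" "\<forall>x\<in>K. f t x = l x" by blast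
      show ?thesis using lip[OF l(1)] l(2) unfolding lipschitz_on_def by simp
    qed
    have mf: "f t (midpoint x z) \<le> (f t x + f t z) / 2 - \<alpha> / 8 * (dist x z)\<^sup>2"
      if "t \<in> {1..T}" "x \<in> K" "z \<in> K" for t x z
    proof -
      have "midpoint x z \<in> K" using that K(2) midpoint_in_closed_segment convex_contains_segment by blast
      moreover from f[OF that(1)] obtain l where l: "l \<in> Ls" "\<forall>x\<in>K. f t x = l x" by blast
      ultimately show ?thesis using mid[OF l(1) that(2,3)] that by simp
    qed
    have zK: "z t \<in> K" if "t \<in> {1..T}" for t
      unfolding z_def using that
      by (intro ftl_point(1)[OF K(1) Kne] continuous_intros lipschitz_on_continuous_on[OF lf]) auto
    have "(\<Sum>t=1..T. w t * (measure_pmf.expectation (q (z t)) (f t) - f t y))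
        \<le> (\<Sum>t=1..T. w t * (f t (z t) - f t y) + e * w t)"
    proof (rule sum_mono)
      fix t assume t: "t \<in> {1..T}"
      obtain l where l: "l \<in> Ls" "\<forall>x\<in>K. f t x = l x" using f[OF t] by blast
      have "measure_pmf.expectation (q (z t)) (f t) = measure_pmf.expectation (q (z t)) l"
        unfolding expectation_finite_pmf[OF S(1) qS] by (rule sum.cong) (use l S in auto)
      also have "\<dots> \<le> f t (z t) + e" using q0[OF zK[OF t]] l zK[OF t] by simp
      finally have "w t * measure_pmf.expectation (q (z t)) (f t) \<le> w t * (f t (z t) + e)"
        using w[of t] by (intro mult_left_mono) auto
      then show "w t * (measure_pmf.expectation (q (z t)) (f t) - f t y) \<le> w t * (f t (z t) - f t y) + e * w t"
        by (simp add: algebra_simps)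
    qed
    also have "\<dots> = (\<Sum>t=1..T. w t * (f t (z t) - f t y)) + e * (\<Sum>t=1..T. w t)"
      by (simp add: sum.distrib sum_distrib_left)
    also have "(\<Sum>t=1..T. w t * (f t (z t) - f t y)) \<le> 8 * L\<^sup>2 / \<alpha> * ln (1 + real T)"
      unfolding z_def by (rule ftl_regret[OF K y \<alpha> lf mf w])
    finally show "(\<Sum>t=1..T. w t * (measure_pmf.expectation (q (ftl_point K (\<lambda>x. \<Sum>\<tau>=1..<t. w \<tau> * f \<tau> x))) (f t) - f t y))
        \<le> 8 * L\<^sup>2 / \<alpha> * ln (1 + real T) + e * (\<Sum>t=1..T. w t)"
      unfolding z_def by simp
  qed (use n in auto)
qed

subsection \<open>Strong convexity\<close>

text \<open>
  The Lipschitz condition also yields subgradients at relative boundary points: the strict epigraph is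
  separated from the downward cone of slope \<open>L\<close> at \<open>(m, f m)\<close>.
\<close>

lemma subgradient_exists:
  fixes f :: "'a::euclidean_space \<Rightarrow> real"
  assumes f: "convex_on K f" "L-lipschitz_on K f" and m: "m \<in> K"
  obtains g where "\<And>z. z \<in> K \<Longrightarrow> f z \<ge> f m + g \<bullet> (z - m)"
proof -
  define A where "A = {p. fst p \<in> K \<and> f (fst p) < snd p}"
  define B where "B = {p. snd p \<le> f m - L * norm (fst p - m)}"
  have cvK: "convex K" using f(1) by (rule convex_on_imp_convex)
  have L: "L \<ge> 0" using f(2) by (rule lipschitz_on_nonneg)
  have "convex A" unfolding A_def
  proof (rule convexI, clarsimp)
    fix x r y s u v assume *: "x \<in> K" "f x < r" "y \<in> K" "f y < s" "0 \<le> u" "0 \<le> v" "u + v = (1::real)"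
    have "f (u *\<^sub>R x + v *\<^sub>R y) \<le> u * f x + v * f y"
      using f(1) * unfolding convex_on_def by blast
    also have "\<dots> < u * r + v * s"
    proof (cases "u = 0")
      case False
      then have "u * f x < u * r" using * by simp
      moreover have "v * f y \<le> v * s" using * by (intro mult_left_mono) auto
      ultimately show ?thesis by simp
    qed (use * in simp)
    finally show "u *\<^sub>R x + v *\<^sub>R y \<in> K \<and> f (u *\<^sub>R x + v *\<^sub>R y) < u * r + v * s"
      using cvK * by (auto simp: convex_def)
  qed
  moreover have "convex B" unfolding B_def
  proof (rule convexI, clarsimp)
    fix x r y s u v assume *: "r \<le> f m - L * norm (x - m)" "s \<le> f m - L * norm (y - m)"
      "0 \<le> u" "0 \<le> v" "u + v = (1::real)"
    have v: "v = 1 - u" using * by simp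
    have "u *\<^sub>R x + v *\<^sub>R y - m = u *\<^sub>R (x - m) + v *\<^sub>R (y - m)" unfolding v by (simp add: algebra_simps)
    then have "norm (u *\<^sub>R x + v *\<^sub>R y - m) \<le> u * norm (x - m) + v * norm (y - m)"
      using norm_triangle_ineq[of "u *\<^sub>R (x - m)" "v *\<^sub>R (y - m)"] * by simp
    then have "L * norm (u *\<^sub>R x + v *\<^sub>R y - m) \<le> L * (u * norm (x - m) + v * norm (y - m))"
      using L by (intro mult_left_mono)
    moreover have "u * r \<le> u * (f m - L * norm (x - m))" "v * s \<le> v * (f m - L * norm (y - m))"
      using * by (auto intro!: mult_left_mono)
    ultimately show "u * r + v * s \<le> f m - L * norm (u *\<^sub>R x + v *\<^sub>R y - m)"
      unfolding v by (simp add: algebra_simps)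
  qed
  moreover have "(m, f m + 1) \<in> A" "(m, f m) \<in> B" using m by (auto simp: A_def B_def)
  moreover have "A \<inter> B = {}"
  proof -
    have "f m - L * norm (x - m) \<le> f x" if "x \<in> K" for x
      using lipschitz_onD[OF f(2) m that] by (simp add: dist_real_def dist_norm norm_minus_commute abs_le_iff)
    then show ?thesis unfolding A_def B_def by fastforce
  qed
  ultimately obtain a c where a: "a \<noteq> 0" "\<And>p. p \<in> A \<Longrightarrow> a \<bullet> p \<le> c" "\<And>p. p \<in> B \<Longrightarrow> a \<bullet> p \<ge> c"
    using separating_hyperplane_sets[of A B] by blast
  obtain h b where hb: "a = (h, b)" by (cases a)
  have A: "h \<bullet> x + b * r \<le> c" if "x \<in> K" "f x < r" for x r
    using a(2)[of "(x, r)"] that by (simp add: A_def hb)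
  have B: "h \<bullet> x + b * (f m - L * norm (x - m)) \<ge> c" for x
    using a(3)[of "(x, f m - L * norm (x - m))"] by (simp add: B_def hb)
  have b: "b < 0"
  proof -
    have "h \<bullet> m + b * (f m + 1) \<le> h \<bullet> m + b * f m" using A[OF m, of "f m + 1"] B[of m] by simp
    then have "b \<le> 0" by (simp add: algebra_simps)
    \<comment> \<open>The separating hyperplane is not vertical: the cone \<open>B\<close> lies over
      the whole space and not only over \<open>K\<close>, so \<open>b = 0\<close> would force
      \<open>h = 0\<close>, as the test point \<open>m - h\<close> shows.\<close>
    moreover have "b \<noteq> 0"
    proof
      assume b0: "b = 0"
      have "h \<bullet> m \<le> c" using A[OF m, of "f m + 1"] b0 by simp
      moreover have "h \<bullet> (m - h) \<ge> c" using B[of "m - h"] b0 by simp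
      ultimately have "h \<bullet> h \<le> 0" by (simp add: inner_diff_right)
      then have "h = 0" by (metis inner_ge_zero inner_eq_zero_iff antisym)
      then show False using a(1) hb b0 by (simp add: zero_prod_def)
    qed
    ultimately show ?thesis by simp
  qed
  show thesis
  proof
    fix z assume z: "z \<in> K"
    have "h \<bullet> z + b * f z \<le> h \<bullet> m + b * f m"
    \<comment> \<open>\<open>A\<close> contains only points strictly above the graph, so the value
      \<open>f z\<close> itself is reached as a limit.\<close>
    proof (rule field_le_epsilon)
      fix \<epsilon> :: real assume \<epsilon>: "\<epsilon> > 0"
      have "f z < f z + \<epsilon> / (- b)" using \<epsilon> b by (simp add: divide_pos_neg)
      from A[OF z this] have "h \<bullet> z + b * (f z + \<epsilon> / (- b)) \<le> c" .
      moreover have "b * (f z + \<epsilon> / (- b)) = b * f z - \<epsilon>" using b by (simp add: field_simps)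
      ultimately show "h \<bullet> z + b * f z \<le> h \<bullet> m + b * f m + \<epsilon>" using B[of m] by simp
    qed
    then have "h \<bullet> (z - m) \<le> (f z - f m) * (- b)" by (simp add: inner_diff_right algebra_simps)
    then have "h \<bullet> (z - m) / (- b) \<le> f z - f m" using b by (subst pos_divide_le_eq) auto
    then show "f z \<ge> f m + (h /\<^sub>R (- b)) \<bullet> (z - m)" by (simp add: divide_inverse mult.commute)
  qed
qed

text \<open>The quadratic lower bound in \<open>strongly_convex_on\<close> speaks only about
  subgradients, so one is first produced at the midpoint; adding its inequalities at
  \<open>x\<close> and \<open>y\<close> cancels the linear terms.\<close>

lemma strongly_convex_midpoint:
  fixes f :: "'a::euclidean_space \<Rightarrow> real"
  assumes f: "strongly_convex_on \<alpha> K f" "L-lipschitz_on K f" and xy: "x \<in> K" "y \<in> K"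
  shows "f (midpoint x y) \<le> (f x + f y) / 2 - \<alpha> / 8 * (dist x y)\<^sup>2"
proof -
  define m where "m = midpoint x y"
  have cv: "convex_on K f" using f unfolding strongly_convex_on_def by simp
  have m: "m \<in> K" unfolding m_def
    using xy convex_on_imp_convex[OF cv] midpoint_in_closed_segment convex_contains_segment by blast
  obtain g where g: "\<And>z. z \<in> K \<Longrightarrow> f z \<ge> f m + g \<bullet> (z - m)"
    using subgradient_exists[OF cv f(2) m] by blast
  have *: "f z - f m - g \<bullet> (z - m) \<ge> \<alpha> / 2 * (norm (z - m))\<^sup>2" if "z \<in> K" for z
    using f(1) m that g unfolding strongly_convex_on_def by blast
  have n: "norm (x - m) = dist x y / 2" "norm (y - m) = dist x y / 2"
    using dist_midpoint[of x y] unfolding m_def by (simp_all add: dist_norm norm_minus_commute)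
  then have "f x + f y - 2 * f m - (g \<bullet> (x - m) + g \<bullet> (y - m)) \<ge> \<alpha> / 4 * (dist x y)\<^sup>2"
    using *[OF xy(1)] *[OF xy(2)] unfolding n power_divide by simp
  moreover have "g \<bullet> (x - m) + g \<bullet> (y - m) = 0"
  proof -
    have "(x - m) + (y - m) = 0" by (simp add: m_def midpoint_def algebra_simps flip: scaleR_2)
    then show ?thesis by (metis inner_add_right inner_zero_right)
  qed
  ultimately show ?thesis unfolding m_def by (simp add: field_simps)
qed

text \<open>Take a pair at distance 1. Passing to the midpoint lowers the average loss by at least
  \<open>\<alpha> / 8\<close> by strong convexity, and by at most \<open>L / 2\<close> by the
  Lipschitz condition.\<close>

lemma strong_convexity_le_lipschitz:
  fixes K :: "'a::euclidean_space set"
  assumes K: "compact K" "diameter K = 1" and l: "strongly_convex_on \<alpha> K l" "L-lipschitz_on K l"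
  shows "\<alpha> \<le> 4 * L"
proof -
  have "K \<noteq> {}" using K(2) by fastforce
  then obtain x y where xy: "x \<in> K" "y \<in> K" "dist x y = 1"
    using diameter_compact_attained[OF K(1)] K(2) by auto
  have "convex K" using l(1) convex_on_imp_convex unfolding strongly_convex_on_def by blast
  then have m: "midpoint x y \<in> K"
    using xy midpoint_in_closed_segment convex_contains_segment by blast
  have d: "dist x (midpoint x y) = 1/2" "dist y (midpoint x y) = 1/2"
    using dist_midpoint[of x y] xy(3) by (simp_all add: dist_commute)
  have "2 * (l x - l (midpoint x y)) \<le> L" "2 * (l y - l (midpoint x y)) \<le> L"
    using lipschitz_onD[OF l(2) xy(1) m] lipschitz_onD[OF l(2) xy(2) m]
      abs_ge_self[of "l x - l (midpoint x y)"] abs_ge_self[of "l y - l (midpoint x y)"]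
    unfolding d dist_real_def by argo+
  moreover have "8 * l (midpoint x y) \<le> 4 * l x + 4 * l y - \<alpha>"
    using strongly_convex_midpoint[OF l xy(1,2)] unfolding xy(3) power_one by argo
  ultimately show ?thesis by argo
qed

subsection \<open>Rounding sets\<close>

lemma sum_map_pmf:
  fixes h :: "'b \<Rightarrow> 'c::{banach, second_countable_topology}"
  assumes "finite A" "set_pmf q \<subseteq> A"
  shows "(\<Sum>s\<in>f ` A. pmf (map_pmf f q) s *\<^sub>R h s) = (\<Sum>a\<in>A. pmf q a *\<^sub>R h (f a))"
proof -
  have "measure_pmf.expectation (map_pmf f q) h = (\<Sum>s\<in>f ` A. pmf (map_pmf f q) s *\<^sub>R h s)"
    using assms by (intro integral_measure_pmf) auto
  moreover have "measure_pmf.expectation q (\<lambda>a. h (f a)) = (\<Sum>a\<in>A. pmf q a *\<^sub>R h (f a))"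
    using assms by (intro integral_measure_pmf) auto
  ultimately show ?thesis by simp
qed

section \<open>The paraboloid lift of \<open>K\<close>\<close>

lemma compact_paraboloid_cap:
  fixes K :: "'a::euclidean_space set"
  assumes "compact K"
  shows "compact {p. fst p \<in> K \<and> (norm (fst p - c))\<^sup>2 \<le> snd p \<and> snd p \<le> (1::real)}" (is "compact ?H")
proof -
  have "?H = (K \<times> {0..1}) \<inter> {p. (norm (fst p - c))\<^sup>2 \<le> snd p}"
    by (auto intro: order_trans[OF zero_le_power2])
  moreover have "closed {p::'a \<times> real. (norm (fst p - c))\<^sup>2 \<le> snd p}"
    by (intro closed_Collect_le continuous_intros)
  ultimately show ?thesis using assms by (simp add: compact_Times compact_Int_closed)
qed

lemma convex_paraboloid_cap:
  fixes K :: "'a::euclidean_space set"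
  assumes "convex K"
  shows "convex {p. fst p \<in> K \<and> (norm (fst p - c))\<^sup>2 \<le> snd p \<and> snd p \<le> (1::real)}"
proof (rule convexI, clarsimp)
  fix x r y s and u v :: real
  assume *: "x \<in> K" "(norm (x - c))\<^sup>2 \<le> r" "r \<le> 1" "y \<in> K" "(norm (y - c))\<^sup>2 \<le> s" "s \<le> 1"
    "0 \<le> u" "0 \<le> v" "u + v = 1"
  define a where "a = x - c"
  define b where "b = y - c"
  have v: "v = 1 - u" using * by simp
  have eq: "u *\<^sub>R x + v *\<^sub>R y - c = u *\<^sub>R a + v *\<^sub>R b" unfolding v a_def b_def by (simp add: algebra_simps)
  \<comment> \<open>The convexity defect of the squared norm is an exact square.\<close>
  have "u * (a \<bullet> a) + v * (b \<bullet> b) - (u *\<^sub>R a + v *\<^sub>R b) \<bullet> (u *\<^sub>R a + v *\<^sub>R b) = u * v * ((a - b) \<bullet> (a - b))"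
    unfolding v by (simp add: inner_add_left inner_add_right inner_diff_left inner_diff_right inner_commute[of b a] algebra_simps)
  moreover have "0 \<le> u * v * ((a - b) \<bullet> (a - b))" using * by simp
  moreover have "u * (a \<bullet> a) \<le> u * r" "v * (b \<bullet> b) \<le> v * s"
    using * unfolding a_def b_def dot_square_norm by (auto intro: mult_left_mono)
  ultimately have "(norm (u *\<^sub>R x + v *\<^sub>R y - c))\<^sup>2 \<le> u * r + v * s"
    unfolding eq dot_square_norm[symmetric] by linarith
  moreover have "u * r + v * s \<le> 1" using convex_bound_le[of r 1 s u v] * by simp
  moreover have "u *\<^sub>R x + v *\<^sub>R y \<in> K" using assms * by (simp add: convex_def)
  ultimately show "u *\<^sub>R x + v *\<^sub>R y \<in> K \<and> (norm (u *\<^sub>R x + v *\<^sub>R y - c))\<^sup>2 \<le> u * r + v * s \<and> u * r + v * s \<le> 1"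
    by simp
qed

text \<open>The extra coordinate of the cap dominates the squared distance to \<open>c\<close>. A
  mixture of cap points close to the lift of \<open>y\<close> therefore has a mean squared distance
  to \<open>c\<close> hardly above that of \<open>y\<close>; subtracting the squared distance of its
  mean leaves a small variance. Dudley's exponent in dimension d + 1 at
  \<open>\<epsilon>\<^sup>2\<close> is exactly \<open>- d\<close> in
  \<open>\<epsilon>\<close>.\<close>

lemma quadratic_rounding_set:
  "\<exists>C\<ge>2. \<forall>(K::'a::euclidean_space set) \<epsilon>. compact K \<and> convex K \<and> diameter K = 1 \<and> 0 < \<epsilon> \<and> \<epsilon> \<le> 1 \<longrightarrow>
    (\<exists>S. finite S \<and> S \<noteq> {} \<and> S \<subseteq> K \<and> real (card S) \<le> C * \<epsilon> powr (- real DIM('a)) \<and>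
      (\<forall>y\<in>K. \<exists>q. set_pmf q \<subseteq> S \<and> dist (\<Sum>s\<in>S. pmf q s *\<^sub>R s) y \<le> \<epsilon>\<^sup>2 \<and>
        (\<Sum>s\<in>S. pmf q s * (dist s (\<Sum>s\<in>S. pmf q s *\<^sub>R s))\<^sup>2) \<le> 3 * \<epsilon>\<^sup>2))"
proof -
  obtain C where C: "C > 0" and approx: "\<forall>(H::('a \<times> real) set) c \<delta>. compact H \<and> convex H \<and> H \<noteq> {} \<and>
      H \<subseteq> cball c 2 \<and> 0 < \<delta> \<and> \<delta> \<le> 1 \<longrightarrow>
    (\<exists>S. finite S \<and> S \<noteq> {} \<and> S \<subseteq> H \<and> real (card S) \<le> C * \<delta> powr (- (real DIM('a \<times> real) - 1) / 2) \<and>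
      (\<forall>x\<in>H. \<exists>x'\<in>convex hull S. dist x x' \<le> \<delta>))"
    using dudley_inner_approximation[where 'b = "'a \<times> real"] by (elim exE conjE) (rule that)
  have "\<exists>S. finite S \<and> S \<noteq> {} \<and> S \<subseteq> K \<and> real (card S) \<le> max 2 C * \<epsilon> powr (- real DIM('a)) \<and>
      (\<forall>y\<in>K. \<exists>q. set_pmf q \<subseteq> S \<and> dist (\<Sum>s\<in>S. pmf q s *\<^sub>R s) y \<le> \<epsilon>\<^sup>2 \<and>
        (\<Sum>s\<in>S. pmf q s * (dist s (\<Sum>s\<in>S. pmf q s *\<^sub>R s))\<^sup>2) \<le> 3 * \<epsilon>\<^sup>2)"
    if K: "compact K" "convex K" "diameter K = 1" and \<epsilon>: "0 < \<epsilon>" "\<epsilon> \<le> 1" for K :: "'a set" and \<epsilon>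
  proof -
    obtain c where c: "c \<in> K" using K(3) by fastforce
    have D: "dist x y \<le> 1" if "x \<in> K" "y \<in> K" for x y
      using diameter_bounded_bound[OF compact_imp_bounded[OF K(1)] that] K(3) by simp
    define H where "H = {p. fst p \<in> K \<and> (norm (fst p - c))\<^sup>2 \<le> snd p \<and> snd p \<le> (1::real)}"
    have lift: "(y, (norm (y - c))\<^sup>2) \<in> H" if "y \<in> K" for y
      using D[OF that c] that by (simp add: H_def dist_norm power_le_one)
    have "H \<subseteq> cball (c, 0) 2"
    proof
      fix p assume p: "p \<in> H"
      obtain x r where [simp]: "p = (x, r)" by (cases p)
      have x: "x \<in> K" "(norm (x - c))\<^sup>2 \<le> r" "r \<le> 1" using p by (auto simp: H_def)
      then have "\<bar>r\<bar> \<le> 1" using order_trans[OF zero_le_power2 x(2)] by simp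
      moreover have "norm (x - c) \<le> 1" using D[OF x(1) c] by (simp add: dist_norm)
      ultimately have "norm (x - c, r) \<le> 2" using norm_Pair_le[of "x - c" r] by simp
      then have "dist p (c, 0) \<le> 2" by (simp add: dist_norm)
      then show "p \<in> cball (c, 0) 2" by (simp add: dist_commute)
    qed
    moreover have "compact H" "convex H" unfolding H_def
      by (rule compact_paraboloid_cap[OF K(1)], rule convex_paraboloid_cap[OF K(2)])
    moreover have "H \<noteq> {}" using lift[OF c] by blast
    moreover have "0 < \<epsilon>\<^sup>2" "\<epsilon>\<^sup>2 \<le> 1" using \<epsilon> by (auto simp: power_le_one)
    ultimately have "\<exists>S. finite S \<and> S \<noteq> {} \<and> S \<subseteq> H \<and>
        real (card S) \<le> C * (\<epsilon>\<^sup>2) powr (- (real DIM('a \<times> real) - 1) / 2) \<and>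
        (\<forall>x\<in>H. \<exists>x'\<in>convex hull S. dist x x' \<le> \<epsilon>\<^sup>2)"
      by (intro approx[rule_format, where c = "(c, 0)"] conjI)
    then obtain P where P: "finite P" "P \<noteq> {}" "P \<subseteq> H"
        "real (card P) \<le> C * (\<epsilon>\<^sup>2) powr (- (real DIM('a \<times> real) - 1) / 2)"
        and dense: "\<And>x. x \<in> H \<Longrightarrow> \<exists>x'\<in>convex hull P. dist x x' \<le> \<epsilon>\<^sup>2"
      by blast
    define S where "S = fst ` P"
    have "real (card S) \<le> real (card P)" unfolding S_def using card_image_le[OF P(1)] by simp
    also note P(4)
    also have "(\<epsilon>\<^sup>2) powr (- (real DIM('a \<times> real) - 1) / 2) = \<epsilon> powr (- real DIM('a))"
    proof -
      have "\<epsilon>\<^sup>2 = \<epsilon> powr 2" using \<epsilon> by simp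
      then show ?thesis by (simp add: powr_powr)
    qed
    also have "C * \<epsilon> powr (- real DIM('a)) \<le> max 2 C * \<epsilon> powr (- real DIM('a))"
      by (intro mult_right_mono) auto
    finally have card: "real (card S) \<le> max 2 C * \<epsilon> powr (- real DIM('a))" .
    have "\<exists>q. set_pmf q \<subseteq> S \<and> dist (\<Sum>s\<in>S. pmf q s *\<^sub>R s) y \<le> \<epsilon>\<^sup>2 \<and>
        (\<Sum>s\<in>S. pmf q s * (dist s (\<Sum>s\<in>S. pmf q s *\<^sub>R s))\<^sup>2) \<le> 3 * \<epsilon>\<^sup>2" if y: "y \<in> K" for y
    proof -
      define z where "z = (y, (norm (y - c))\<^sup>2)"
      obtain x' where x': "x' \<in> convex hull P" "dist z x' \<le> \<epsilon>\<^sup>2" using dense[OF lift[OF y]] z_def by blast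
      obtain p where p: "set_pmf p \<subseteq> P" "(\<Sum>a\<in>P. pmf p a *\<^sub>R a) = x'"
        using pmf_of_convex_hull[OF P(1) x'(1)] by blast
      define m where "m = fst x'"
      \<comment> \<open>Several points of \<open>P\<close> may lie over the same point of
        \<open>K\<close>; the push-forward merges their weights.\<close>
      define q where "q = map_pmf fst p"
      have m: "m = (\<Sum>a\<in>P. pmf p a *\<^sub>R fst a)" unfolding m_def p(2)[symmetric] by (simp add: fst_sum)
      have r: "snd x' = (\<Sum>a\<in>P. pmf p a * snd a)" unfolding p(2)[symmetric] by (simp add: snd_sum)
      have one: "(\<Sum>a\<in>P. pmf p a) = 1" by (rule sum_pmf_eq_1[OF P(1) p(1)])
      have qm: "(\<Sum>s\<in>S. pmf q s *\<^sub>R s) = m"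
        unfolding S_def q_def m by (rule sum_map_pmf[OF P(1) p(1)])
      have qq: "(\<Sum>s\<in>S. pmf q s * (dist s m)\<^sup>2) = (\<Sum>a\<in>P. pmf p a * (dist (fst a) m)\<^sup>2)"
        using sum_map_pmf[OF P(1) p(1), of fst "\<lambda>s. (dist s m)\<^sup>2"] unfolding S_def q_def by simp
      have my: "dist m y \<le> \<epsilon>\<^sup>2"
        using dist_fst_le[of x' z] x'(2) by (simp add: m_def z_def dist_commute)
      have ry: "snd x' \<le> (norm (y - c))\<^sup>2 + \<epsilon>\<^sup>2"
        using dist_snd_le[of x' z] x'(2) by (simp add: z_def dist_commute dist_real_def abs_le_iff)
      have "P \<subseteq> K \<times> UNIV" using P(3) by (auto simp: H_def)
      \<comment> \<open>Diameter 1 bounds both norms by 1, so the difference of squares costs twice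
        the displacement of the mean. With the error in the last coordinate this gives the constant
        3.\<close>
      then have "m \<in> K" unfolding m using K(2) P(1) one by (intro convex_sum) auto
      then have "norm (m - c) \<le> 1" "norm (y - c) \<le> 1" using D c y by (auto simp: dist_norm)
      moreover have "norm (y - c) - norm (m - c) \<le> \<epsilon>\<^sup>2"
        using norm_triangle_ineq2[of "y - c" "m - c"] my by (simp add: dist_norm norm_minus_commute)
      ultimately have "(norm (y - c) - norm (m - c)) * (norm (y - c) + norm (m - c)) \<le> \<epsilon>\<^sup>2 * 2"
        by (intro mult_mono) auto
      then have ym: "(norm (y - c))\<^sup>2 - (norm (m - c))\<^sup>2 \<le> 2 * \<epsilon>\<^sup>2"
        by (simp add: power2_eq_square algebra_simps)
      define v where "v = m - c"
      have "(\<Sum>a\<in>P. pmf p a * (dist (fst a) m)\<^sup>2)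
          \<le> (\<Sum>a\<in>P. pmf p a * (snd a + (norm v)\<^sup>2 - 2 * ((fst a - c) \<bullet> v)))"
      proof (intro sum_mono mult_left_mono)
        fix a assume "a \<in> P"
        then have "(norm (fst a - c))\<^sup>2 \<le> snd a" using P(3) by (auto simp: H_def)
        moreover have "(dist (fst a) m)\<^sup>2 = (norm (fst a - c))\<^sup>2 + (norm v)\<^sup>2 - 2 * ((fst a - c) \<bullet> v)"
        proof -
          have "fst a - m = (fst a - c) - v" by (simp add: v_def)
          moreover have "(norm (b - v))\<^sup>2 = (norm b)\<^sup>2 + (norm v)\<^sup>2 - 2 * (b \<bullet> v)" for b
            unfolding dot_square_norm[symmetric]
            by (simp add: inner_diff_left inner_diff_right inner_commute)
          ultimately show ?thesis unfolding dist_norm by metis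
        qed
        ultimately show "(dist (fst a) m)\<^sup>2 \<le> snd a + (norm v)\<^sup>2 - 2 * ((fst a - c) \<bullet> v)" by simp
      qed simp
      also have "\<dots> = (\<Sum>a\<in>P. pmf p a * snd a) + (\<Sum>a\<in>P. pmf p a) * ((norm v)\<^sup>2 + 2 * (c \<bullet> v))
          - 2 * ((\<Sum>a\<in>P. pmf p a *\<^sub>R fst a) \<bullet> v)"
        by (simp add: inner_diff_left inner_sum_left sum.distrib sum_subtractf sum_distrib_left sum_distrib_right algebra_simps)
      also have "\<dots> = snd x' - (norm v)\<^sup>2"
        unfolding one r[symmetric] m[symmetric] unfolding v_def dot_square_norm[symmetric]
        by (simp add: inner_diff_left inner_diff_right inner_commute algebra_simps)
      also have "\<dots> \<le> 3 * \<epsilon>\<^sup>2" using ry ym by (simp add: v_def)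
      finally show ?thesis
        using my p(1) qm qq by (intro exI[of _ q]) (auto simp: q_def S_def)
    qed
    moreover have "finite S" "S \<noteq> {}" "S \<subseteq> K" using P by (auto simp: S_def H_def)
    ultimately show ?thesis using card by blast
  qed
  then show ?thesis by (intro exI[of _ "max 2 C"]) auto
qed

text \<open>The spread around \<open>m\<close> costs \<open>2 * L * \<epsilon>\<close>, the
  displacement from \<open>m\<close> to \<open>y\<close> at most
  \<open>L * \<epsilon>\<close>.\<close>

lemma expectation_lipschitz_rounding:
  fixes K :: "'a::euclidean_space set"
  assumes l: "L-lipschitz_on K l" and S: "finite S" "S \<subseteq> K" "set_pmf q \<subseteq> S" and m: "m \<in> K" "y \<in> K"
    and \<epsilon>: "0 < \<epsilon>" "\<epsilon> \<le> 1" and my: "dist m y \<le> \<epsilon>\<^sup>2" and var: "(\<Sum>s\<in>S. pmf q s * (dist s m)\<^sup>2) \<le> 3 * \<epsilon>\<^sup>2"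
  shows "measure_pmf.expectation q l \<le> l y + 3 * L * \<epsilon>"
proof -
  have L: "L \<ge> 0" by (rule lipschitz_on_nonneg[OF l])
  have one: "(\<Sum>s\<in>S. pmf q s) = 1" by (rule sum_pmf_eq_1[OF S(1,3)])
  \<comment> \<open>AM-GM bounds the first moment by the second, in place of Cauchy-Schwarz.\<close>
  have am_gm: "dist s m \<le> (dist s m)\<^sup>2 / (2 * \<epsilon>) + \<epsilon> / 2" for s
    using zero_le_power2[of "dist s m - \<epsilon>"] \<epsilon> by (simp add: power2_diff field_simps) (simp add: power2_eq_square)
  have "l s \<le> l m + L * ((dist s m)\<^sup>2 / (2 * \<epsilon>) + \<epsilon> / 2)" if "s \<in> S" for s
  proof -
    have "l s - l m \<le> L * dist s m"
      using lipschitz_onD[OF l, of s m] that S m by (auto simp: dist_real_def)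
    also have "\<dots> \<le> L * ((dist s m)\<^sup>2 / (2 * \<epsilon>) + \<epsilon> / 2)" using am_gm L by (rule mult_left_mono)
    finally show ?thesis by simp
  qed
  then have "measure_pmf.expectation q l \<le> (\<Sum>s\<in>S. pmf q s * (l m + L * ((dist s m)\<^sup>2 / (2 * \<epsilon>) + \<epsilon> / 2)))"
    unfolding expectation_finite_pmf[OF S(1,3)] by (intro sum_mono mult_left_mono) auto
  also have "\<dots> = (\<Sum>s\<in>S. pmf q s) * (l m + L * \<epsilon> / 2) + L / (2 * \<epsilon>) * (\<Sum>s\<in>S. pmf q s * (dist s m)\<^sup>2)"
    unfolding sum_distrib_left sum_distrib_right sum.distrib[symmetric]
    by (rule sum.cong) (simp_all add: algebra_simps add_divide_distrib)
  also have "\<dots> \<le> 1 * (l m + L * \<epsilon> / 2) + L / (2 * \<epsilon>) * (3 * \<epsilon>\<^sup>2)"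
    unfolding one using L \<epsilon> by (intro add_left_mono mult_left_mono var) auto
  also have "\<dots> = l m + 2 * L * \<epsilon>" using \<epsilon> by (simp add: power2_eq_square)
  also have "l m \<le> l y + L * \<epsilon>"
  proof -
    have "l m - l y \<le> L * dist m y" using lipschitz_onD[OF l m] by (simp add: dist_real_def)
    also have "\<dots> \<le> L * \<epsilon>" using my L \<epsilon> power_decreasing[of 1 2 \<epsilon>] by (intro mult_left_mono) auto
    finally show ?thesis by simp
  qed
  finally show ?thesis by simp
qed

text \<open>Expanding at the exact mean \<open>m\<close> kills the first-order term in expectation;
  only the variance and the displacement of the mean remain, both of order
  \<open>\<epsilon>\<^sup>2\<close>.\<close>

lemma expectation_smooth_rounding:
  fixes K :: "'a::euclidean_space set"
  assumes l: "L-lipschitz_on K l" "smooth_on \<beta> K l" and \<beta>: "\<beta> > 0" and S: "finite S" "S \<subseteq> K" "set_pmf q \<subseteq> S"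
    and m: "m \<in> K" "y \<in> K" and mean: "(\<Sum>s\<in>S. pmf q s *\<^sub>R s) = m"
    and my: "dist m y \<le> \<epsilon>\<^sup>2" and var: "(\<Sum>s\<in>S. pmf q s * (dist s m)\<^sup>2) \<le> 3 * \<epsilon>\<^sup>2"
  shows "measure_pmf.expectation q l \<le> l y + 2 * (L + \<beta>) * \<epsilon>\<^sup>2"
proof -
  have L: "L \<ge> 0" by (rule lipschitz_on_nonneg[OF l(1)])
  have one: "(\<Sum>s\<in>S. pmf q s) = 1" by (rule sum_pmf_eq_1[OF S(1,3)])
  obtain g where g: "\<And>x y. x \<in> K \<Longrightarrow> y \<in> K \<Longrightarrow> l y - l x - g x \<bullet> (y - x) \<le> \<beta> / 2 * (norm (y - x))\<^sup>2"
    using l(2) unfolding smooth_on_def by blast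
  have "measure_pmf.expectation q l \<le> (\<Sum>s\<in>S. pmf q s * (l m + g m \<bullet> (s - m) + \<beta> / 2 * (dist s m)\<^sup>2))"
    unfolding expectation_finite_pmf[OF S(1,3)]
  proof (intro sum_mono mult_left_mono)
    fix s assume "s \<in> S"
    then show "l s \<le> l m + g m \<bullet> (s - m) + \<beta> / 2 * (dist s m)\<^sup>2"
      using g[OF m(1), of s] S(2) by (auto simp: dist_norm)
  qed simp
  also have "\<dots> = (\<Sum>s\<in>S. pmf q s) * (l m - g m \<bullet> m) + g m \<bullet> (\<Sum>s\<in>S. pmf q s *\<^sub>R s)
      + \<beta> / 2 * (\<Sum>s\<in>S. pmf q s * (dist s m)\<^sup>2)"
    by (simp add: sum_distrib_left sum_distrib_right inner_sum_right inner_diff_right sum.distrib[symmetric] algebra_simps)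
  also have "\<dots> = l m + \<beta> / 2 * (\<Sum>s\<in>S. pmf q s * (dist s m)\<^sup>2)" unfolding one mean by simp
  also have "\<dots> \<le> (l y + L * \<epsilon>\<^sup>2) + \<beta> / 2 * (3 * \<epsilon>\<^sup>2)"
  proof (intro add_mono mult_left_mono var)
    have "l m - l y \<le> L * dist m y" using lipschitz_onD[OF l(1) m] by (simp add: dist_real_def)
    also have "\<dots> \<le> L * \<epsilon>\<^sup>2" using my L by (rule mult_left_mono)
    finally show "l m \<le> l y + L * \<epsilon>\<^sup>2" by simp
  qed (use \<beta> in simp)
  also have "\<dots> \<le> l y + 2 * (L + \<beta>) * \<epsilon>\<^sup>2"
  proof -
    have "0 \<le> L * \<epsilon>\<^sup>2" "0 \<le> \<beta> * \<epsilon>\<^sup>2" using L \<beta> by auto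
    then show ?thesis by (simp add: algebra_simps)
  qed
  finally show ?thesis .
qed

text \<open>The order of quantifiers matters: one \<open>S\<close> and, for each \<open>y\<close>,
  one \<open>q\<close> serve all losses and all values of \<open>L\<close> and
  \<open>\<beta>\<close>.\<close>

lemma rounding_set:
  "\<exists>C\<ge>2. \<forall>(K::'a::euclidean_space set) \<epsilon>. compact K \<and> convex K \<and> diameter K = 1 \<and> 0 < \<epsilon> \<and> \<epsilon> \<le> 1 \<longrightarrow>
    (\<exists>S. finite S \<and> S \<noteq> {} \<and> S \<subseteq> K \<and> real (card S) \<le> C * \<epsilon> powr (- real DIM('a)) \<and>
      (\<forall>y\<in>K. \<exists>q. set_pmf q \<subseteq> S \<and> (\<forall>L l. L-lipschitz_on K l \<longrightarrow>
        measure_pmf.expectation q l \<le> l y + 3 * L * \<epsilon> \<and>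
        (\<forall>\<beta>>0. smooth_on \<beta> K l \<longrightarrow> measure_pmf.expectation q l \<le> l y + 2 * (L + \<beta>) * \<epsilon>\<^sup>2))))"
proof -
  obtain C where C: "C \<ge> 2" and ex: "\<forall>(K::'a set) \<epsilon>. compact K \<and> convex K \<and> diameter K = 1 \<and> 0 < \<epsilon> \<and> \<epsilon> \<le> 1 \<longrightarrow>
    (\<exists>S. finite S \<and> S \<noteq> {} \<and> S \<subseteq> K \<and> real (card S) \<le> C * \<epsilon> powr (- real DIM('a)) \<and>
      (\<forall>y\<in>K. \<exists>q. set_pmf q \<subseteq> S \<and> dist (\<Sum>s\<in>S. pmf q s *\<^sub>R s) y \<le> \<epsilon>\<^sup>2 \<and>
        (\<Sum>s\<in>S. pmf q s * (dist s (\<Sum>s\<in>S. pmf q s *\<^sub>R s))\<^sup>2) \<le> 3 * \<epsilon>\<^sup>2))"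
    using quadratic_rounding_set[where 'a = 'a] by (elim exE conjE) (rule that)
  show ?thesis
  proof (intro exI[of _ C] conjI C allI impI, elim conjE)
    fix K :: "'a set" and \<epsilon> :: real assume K: "compact K" "convex K" "diameter K = 1" and \<epsilon>: "0 < \<epsilon>" "\<epsilon> \<le> 1"
    obtain S where S: "finite S" "S \<noteq> {}" "S \<subseteq> K" "real (card S) \<le> C * \<epsilon> powr (- real DIM('a))"
      and q: "\<And>y. y \<in> K \<Longrightarrow> \<exists>q. set_pmf q \<subseteq> S \<and> dist (\<Sum>s\<in>S. pmf q s *\<^sub>R s) y \<le> \<epsilon>\<^sup>2 \<and>
        (\<Sum>s\<in>S. pmf q s * (dist s (\<Sum>s\<in>S. pmf q s *\<^sub>R s))\<^sup>2) \<le> 3 * \<epsilon>\<^sup>2"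
      using ex[rule_format, OF conjI[OF K(1) conjI[OF K(2) conjI[OF K(3) conjI[OF \<epsilon>]]]]] by blast
    have "\<exists>q. set_pmf q \<subseteq> S \<and> (\<forall>L l. L-lipschitz_on K l \<longrightarrow>
        measure_pmf.expectation q l \<le> l y + 3 * L * \<epsilon> \<and>
        (\<forall>\<beta>>0. smooth_on \<beta> K l \<longrightarrow> measure_pmf.expectation q l \<le> l y + 2 * (L + \<beta>) * \<epsilon>\<^sup>2))" if y: "y \<in> K" for y
    proof -
      obtain q where q: "set_pmf q \<subseteq> S" "dist (\<Sum>s\<in>S. pmf q s *\<^sub>R s) y \<le> \<epsilon>\<^sup>2"
          "(\<Sum>s\<in>S. pmf q s * (dist s (\<Sum>s\<in>S. pmf q s *\<^sub>R s))\<^sup>2) \<le> 3 * \<epsilon>\<^sup>2"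
        using q[OF y] by blast
      have m: "(\<Sum>s\<in>S. pmf q s *\<^sub>R s) \<in> K"
        using K(2) S sum_pmf_eq_1[OF S(1) q(1)] by (intro convex_sum) auto
      show ?thesis
        using q(1) expectation_lipschitz_rounding[OF _ S(1,3) q(1) m y \<epsilon> q(2,3)]
          expectation_smooth_rounding[OF _ _ _ S(1,3) q(1) m y refl q(2,3)] by blast
    qed
    then show "\<exists>S. finite S \<and> S \<noteq> {} \<and> S \<subseteq> K \<and> real (card S) \<le> C * \<epsilon> powr (- real DIM('a)) \<and>
      (\<forall>y\<in>K. \<exists>q. set_pmf q \<subseteq> S \<and> (\<forall>L l. L-lipschitz_on K l \<longrightarrow>
        measure_pmf.expectation q l \<le> l y + 3 * L * \<epsilon> \<and>
        (\<forall>\<beta>>0. smooth_on \<beta> K l \<longrightarrow> measure_pmf.expectation q l \<le> l y + 2 * (L + \<beta>) * \<epsilon>\<^sup>2)))"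
      using S by (intro exI[of _ S]) auto
  qed
qed

text \<open>By Jensen's inequality spreading only lowers a concave loss, so the position of the mean
  is all that counts and Dudley's theorem applies to \<open>K\<close> without a lift.\<close>

lemma expectation_concave_rounding:
  fixes K :: "'a::euclidean_space set"
  assumes l: "L-lipschitz_on K l" "concave_on K l" and S: "finite S" "S \<noteq> {}" "S \<subseteq> K" "set_pmf q \<subseteq> S"
    and y: "y \<in> K" and my: "dist (\<Sum>s\<in>S. pmf q s *\<^sub>R s) y \<le> \<delta>"
  shows "measure_pmf.expectation q l \<le> l y + L * \<delta>"
proof -
  define m where "m = (\<Sum>s\<in>S. pmf q s *\<^sub>R s)"
  have one: "(\<Sum>s\<in>S. pmf q s) = 1" by (rule sum_pmf_eq_1[OF S(1,4)])
  have cv: "convex_on K (\<lambda>x. - l x)" using l(2) by (simp add: concave_on_def)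
  have m: "m \<in> K" unfolding m_def
    using convex_on_imp_convex[OF cv] S one by (intro convex_sum) auto
  have "- l m \<le> (\<Sum>s\<in>S. pmf q s * (- l s))"
    unfolding m_def by (rule convex_on_sum[OF S(1,2) cv one]) (use S in auto)
  then have "measure_pmf.expectation q l \<le> l m"
    unfolding expectation_finite_pmf[OF S(1,4)] by (simp add: sum_negf)
  moreover have "l m - l y \<le> L * dist m y" using lipschitz_onD[OF l(1) m y] by (simp add: dist_real_def)
  moreover have "\<dots> \<le> L * \<delta>"
    using my lipschitz_on_nonneg[OF l(1)] unfolding m_def by (rule mult_left_mono)
  ultimately show ?thesis by simp
qed

subsection \<open>The regret bounds\<close>

lemma achieves_empty: "x \<in> K \<Longrightarrow> T \<ge> 1 \<Longrightarrow> achieves K {} T B"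
  unfolding achieves_def valid_learner_def by (intro exI[of _ "\<lambda>_. return_pmf x"]) auto

text \<open>Meant for \<open>l = ln T\<close>: the rounding cost carries no logarithm, and
  \<open>1 \<le> 2 * l\<close> supplies it.\<close>

lemma absorb_lower_order:
  fixes a b c l u :: real
  assumes "0 \<le> a" "0 \<le> u" "1/2 \<le> l" "2 * a + b \<le> c"
  shows "a * u + b * u * l \<le> c * u * l"
proof -
  have "a * u * 1 \<le> a * u * (2 * l)" using assms by (intro mult_left_mono) auto
  moreover have "(2 * a + b) * (u * l) \<le> c * (u * l)" using assms by (intro mult_right_mono) auto
  ultimately show ?thesis by (simp add: algebra_simps)
qed

lemma ln_one_plus_le:
  assumes "T \<ge> (2::nat)"
  shows "ln (1 + real T) \<le> 2 * ln (real T)"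
proof -
  have "1 + T \<le> T * 2" using assms by simp
  also have "\<dots> \<le> T * T" using assms by simp
  finally have "real (1 + T) \<le> real (T * T)" by (rule of_nat_mono)
  then have "1 + real T \<le> real T * real T" by simp
  then have "ln (1 + real T) \<le> ln (real T * real T)" using assms by (subst ln_le_cancel_iff) auto
  also have "\<dots> = 2 * ln (real T)" using assms by (subst ln_mult) auto
  finally show ?thesis .
qed

theorem theorem3:
  shows "\<exists>C::real. C > 0 \<and>
    (\<forall>(K::'a::euclidean_space set) (L::real) (Ls::('a \<Rightarrow> real) set) (T::nat).
      compact K \<and> convex K \<and> diameter K = 1 \<and> L > 0 \<and> (\<forall>l\<in>Ls. L-lipschitz_on K l) \<and> T \<ge> 2 \<longrightarrow>
      (let d = real DIM('a) in
        achieves K Ls T (C * L * real T powr ((d+1)/(d+2)) * ln (real T)) \<and>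
        (\<forall>\<beta>>0. (\<forall>l\<in>Ls. smooth_on \<beta> K l) \<longrightarrow>
           achieves K Ls T (C * (L + \<beta>) * real T powr ((d+2)/(d+4)) * ln (real T))) \<and>
        ((\<forall>l\<in>Ls. concave_on K l) \<longrightarrow>
           achieves K Ls T (C * L * real T powr ((d+1)/(d+3)) * ln (real T))) \<and>
        (\<forall>\<alpha>>0. (\<forall>l\<in>Ls. strongly_convex_on \<alpha> K l) \<longrightarrow>
           achieves K Ls T (C * L * (L/\<alpha>) powr (1/(d+1)) * real T powr (d/(d+1)) * ln (real T))) \<and>
        (\<forall>\<alpha>>0. \<forall>\<beta>>0. (\<forall>l\<in>Ls. strongly_convex_on \<alpha> K l \<and> smooth_on \<beta> K l) \<longrightarrow>
           achieves K Ls T (C * L * (\<beta>/L + L/\<alpha>) * real T powr (d/(d+2)) * ln (real T)))))"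
proof -
  obtain C1 where C1: "C1 \<ge> 2" and rs: "\<forall>(K::'a set) \<epsilon>. compact K \<and> convex K \<and> diameter K = 1 \<and> 0 < \<epsilon> \<and> \<epsilon> \<le> 1 \<longrightarrow>
    (\<exists>S. finite S \<and> S \<noteq> {} \<and> S \<subseteq> K \<and> real (card S) \<le> C1 * \<epsilon> powr (- real DIM('a)) \<and>
      (\<forall>y\<in>K. \<exists>q. set_pmf q \<subseteq> S \<and> (\<forall>L l. L-lipschitz_on K l \<longrightarrow>
        measure_pmf.expectation q l \<le> l y + 3 * L * \<epsilon> \<and>
        (\<forall>\<beta>>0. smooth_on \<beta> K l \<longrightarrow> measure_pmf.expectation q l \<le> l y + 2 * (L + \<beta>) * \<epsilon>\<^sup>2))))"
    using rounding_set[where 'a = 'a] by (elim exE conjE) (rule that)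
  obtain C0 where C0: "C0 > 0" and dudley: "\<forall>(K::'a set) c \<delta>. compact K \<and> convex K \<and> K \<noteq> {} \<and> K \<subseteq> cball c 2 \<and> 0 < \<delta> \<and> \<delta> \<le> 1 \<longrightarrow>
    (\<exists>S. finite S \<and> S \<noteq> {} \<and> S \<subseteq> K \<and> real (card S) \<le> C0 * \<delta> powr (- (real DIM('a) - 1) / 2) \<and>
      (\<forall>x\<in>K. \<exists>x'\<in>convex hull S. dist x x' \<le> \<delta>))"
    using dudley_inner_approximation[where 'b = 'a] by (elim exE conjE) (rule that)
  define C2 where "C2 = max 2 C0"
  have C2: "C2 \<ge> 2" "C0 \<le> C2" by (auto simp: C2_def)
  \<comment> \<open>\<open>absorb_lower_order\<close> asks for \<open>2 * a + b \<le> C\<close> in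
    each case. The largest demands are \<open>24 + 16 * C1\<close>, from the strongly convex and
    smooth case, and \<open>2 + 7 * C2\<close>, from the concave case; \<open>C1\<close> and
    \<open>C2\<close> are at least 2.\<close>
  define C where "C = 28 * C1 + 8 * C2"
  show ?thesis
  proof (intro exI[of _ C] conjI allI impI, goal_cases)
    case 1
    then show ?case using C1 C2 by (simp add: C_def)
  next
    case (2 K L Ls T)
    then have K: "compact K" "convex K" "diameter K = 1" and L: "L > 0"
      and lip: "\<And>l. l \<in> Ls \<Longrightarrow> L-lipschitz_on K l" and T: "T \<ge> 2" by auto
    define d where "d = real DIM('a)"
    have d: "d \<ge> 1" unfolding d_def by (simp add: Suc_leI)
    have Tr: "real T \<ge> 2" using T by simp
    have lnT: "1/2 \<le> ln T" by (rule half_le_ln[OF T])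
    obtain c where c: "c \<in> K" using K(3) by fastforce
    have D: "dist x y \<le> 1" if "x \<in> K" "y \<in> K" for x y
      using diameter_bounded_bound[OF compact_imp_bounded[OF K(1)] that] K(3) by simp
    have range: "\<bar>l x - l y\<bar> \<le> L" if "l \<in> Ls" "x \<in> K" "y \<in> K" for l x y
    proof -
      have "\<bar>l x - l y\<bar> \<le> L * dist x y"
        using lipschitz_onD[OF lip[OF that(1)] that(2,3)] by (simp add: dist_real_def)
      also have "\<dots> \<le> L * 1" using D[OF that(2,3)] L by (intro mult_left_mono) auto
      finally show ?thesis by simp
    qed
    have small: "0 < real T powr - a" "real T powr - a \<le> 1" if "a \<ge> 0" for a :: real
      using Tr that powr_mono[of "-a" 0 "real T"] by auto
    have T_mult: "real T powr a * real T = real T powr (a + 1)" for a :: real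
      using Tr by (simp add: powr_add)
    have sets: "\<exists>S. finite S \<and> S \<subseteq> K \<and> S \<noteq> {} \<and> real (card S) \<le> C1 * \<epsilon> powr (- d) \<and>
        (\<forall>y\<in>K. \<exists>q. set_pmf q \<subseteq> S \<and> (\<forall>l\<in>Ls. measure_pmf.expectation q l \<le> l y + 3 * L * \<epsilon>)) \<and>
        (\<forall>\<beta>>0. (\<forall>l\<in>Ls. smooth_on \<beta> K l) \<longrightarrow>
          (\<forall>y\<in>K. \<exists>q. set_pmf q \<subseteq> S \<and> (\<forall>l\<in>Ls. measure_pmf.expectation q l \<le> l y + 2 * (L + \<beta>) * \<epsilon>\<^sup>2)))"
      if \<epsilon>: "0 < \<epsilon>" "\<epsilon> \<le> 1" for \<epsilon> :: real
    proof -
      obtain S where S: "finite S" "S \<noteq> {}" "S \<subseteq> K" "real (card S) \<le> C1 * \<epsilon> powr (- d)"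
        and q: "\<forall>y\<in>K. \<exists>q. set_pmf q \<subseteq> S \<and> (\<forall>L l. L-lipschitz_on K l \<longrightarrow>
        measure_pmf.expectation q l \<le> l y + 3 * L * \<epsilon> \<and>
        (\<forall>\<beta>>0. smooth_on \<beta> K l \<longrightarrow> measure_pmf.expectation q l \<le> l y + 2 * (L + \<beta>) * \<epsilon>\<^sup>2))"
        using rs[rule_format, OF conjI[OF K(1) conjI[OF K(2) conjI[OF K(3) conjI[OF \<epsilon>]]]]]
        unfolding d_def by blast
      have "\<exists>q. set_pmf q \<subseteq> S \<and> (\<forall>l\<in>Ls. measure_pmf.expectation q l \<le> l y + 3 * L * \<epsilon>)" if "y \<in> K" for y
        using q[rule_format, OF that] lip by blast
      moreover have "\<exists>q. set_pmf q \<subseteq> S \<and> (\<forall>l\<in>Ls. measure_pmf.expectation q l \<le> l y + 2 * (L + \<beta>) * \<epsilon>\<^sup>2)"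
        if "y \<in> K" "\<beta> > 0" "\<forall>l\<in>Ls. smooth_on \<beta> K l" for y \<beta>
        using q[rule_format, OF that(1)] lip that(2,3) by blast
      ultimately show ?thesis using S by (intro exI[of _ S] conjI) auto
    qed

    have lipschitz: "achieves K Ls T (C * L * real T powr ((d+1)/(d+2)) * ln (real T))"
    proof -
      \<comment> \<open>Balances \<open>\<epsilon> * T\<close> against Hedge's
        \<open>sqrt (\<epsilon> powr (- d) * T)\<close>.\<close>
      define \<epsilon> where "\<epsilon> = real T powr - (1/(d+2))"
      define X where "X = real T powr ((d+1)/(d+2))"
      have \<epsilon>: "0 < \<epsilon>" "\<epsilon> \<le> 1" unfolding \<epsilon>_def using small d by auto
      obtain S where S: "finite S" "S \<subseteq> K" "S \<noteq> {}" "real (card S) \<le> C1 * \<epsilon> powr (- d)"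
        and q: "\<And>y. y \<in> K \<Longrightarrow> \<exists>q. set_pmf q \<subseteq> S \<and> (\<forall>l\<in>Ls. measure_pmf.expectation q l \<le> l y + 3 * L * \<epsilon>)"
        using sets[OF \<epsilon>] by blast
      have "\<epsilon> powr (- d) = T powr (d/(d+2))" unfolding \<epsilon>_def by (simp add: powr_powr)
      then have ach: "achieves K Ls T (3 * L * \<epsilon> * T + 7 * C1 * L * T powr ((1 + d/(d+2)) / 2) * ln T)"
        using S(4) d by (intro hedge_rate[OF S(1-3) _ C1 _ _ L range q T]) auto
      have \<kappa>: "(1 + d/(d+2)) / 2 = (d+1)/(d+2)" using d by (simp add: field_simps)
      have eT: "\<epsilon> * T = X"
      proof -
        have "- (1/(d+2)) + 1 = (d+1)/(d+2)" using d by (simp add: field_simps)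
        then show ?thesis unfolding \<epsilon>_def X_def T_mult by simp
      qed
      have "3 * L * \<epsilon> * T + 7 * C1 * L * T powr ((1 + d/(d+2)) / 2) * ln T = 3 * (L * X) + 7 * C1 * (L * X) * ln T"
        unfolding \<kappa> X_def[symmetric] eT[symmetric] by (simp add: mult_ac)
      from ach[unfolded this] have "achieves K Ls T (3 * (L * X) + 7 * C1 * (L * X) * ln T)"
        .
      then have "achieves K Ls T (C * (L * X) * ln T)"
        by (rule achieves_mono) (intro absorb_lower_order lnT, use L C1 C2 in \<open>auto simp: X_def C_def\<close>)
      then show ?thesis by (simp add: X_def mult_ac)
    qed

    have smooth: "achieves K Ls T (C * (L + \<beta>) * real T powr ((d+2)/(d+4)) * ln (real T))"
      if \<beta>: "\<beta> > 0" "\<forall>l\<in>Ls. smooth_on \<beta> K l" for \<beta>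
    proof -
      \<comment> \<open>The rounding cost is now \<open>\<epsilon>\<^sup>2 * T\<close>, so a coarser
        set balances Hedge.\<close>
      define \<epsilon> where "\<epsilon> = real T powr - (1/(d+4))"
      define X where "X = real T powr ((d+2)/(d+4))"
      have \<epsilon>: "0 < \<epsilon>" "\<epsilon> \<le> 1" unfolding \<epsilon>_def using small d by auto
      obtain S where S: "finite S" "S \<subseteq> K" "S \<noteq> {}" "real (card S) \<le> C1 * \<epsilon> powr (- d)"
        and q: "\<forall>\<beta>>0. (\<forall>l\<in>Ls. smooth_on \<beta> K l) \<longrightarrow>
          (\<forall>y\<in>K. \<exists>q. set_pmf q \<subseteq> S \<and> (\<forall>l\<in>Ls. measure_pmf.expectation q l \<le> l y + 2 * (L + \<beta>) * \<epsilon>\<^sup>2))"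
        using sets[OF \<epsilon>] by (elim exE conjE) (rule that)
      note q = q[rule_format, OF \<beta>(1) bspec[OF \<beta>(2)]]
      have "\<epsilon> powr (- d) = T powr (d/(d+4))" unfolding \<epsilon>_def by (simp add: powr_powr)
      then have ach: "achieves K Ls T (2 * (L + \<beta>) * \<epsilon>\<^sup>2 * T + 7 * C1 * L * T powr ((1 + d/(d+4)) / 2) * ln T)"
        using S(4) d by (intro hedge_rate[OF S(1-3) _ C1 _ _ L range q T]) auto
      have \<kappa>: "(1 + d/(d+4)) / 2 = (d+2)/(d+4)" using d by (simp add: field_simps)
      have eT: "\<epsilon>\<^sup>2 * T = X"
      proof -
        have e2: "\<epsilon>\<^sup>2 = T powr - (2/(d+4))"
          unfolding \<epsilon>_def power2_eq_square powr_add[symmetric] by (simp add: field_simps)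
        have e1: "- (2/(d+4)) + 1 = (d+2)/(d+4)" using d by (simp add: field_simps)
        show ?thesis unfolding e2 T_mult e1 X_def ..
      qed
      have "2 * (L + \<beta>) * \<epsilon>\<^sup>2 * T + 7 * C1 * L * T powr ((1 + d/(d+4)) / 2) * ln T = 2 * ((L + \<beta>) * X) + 7 * C1 * (L * X) * ln T"
        unfolding \<kappa> X_def[symmetric] eT[symmetric] by (simp add: mult_ac)
      from ach[unfolded this] have 1: "achieves K Ls T (2 * ((L + \<beta>) * X) + 7 * C1 * (L * X) * ln T)"
        .
      have "7 * C1 * (L * X) * ln T \<le> 7 * C1 * ((L + \<beta>) * X) * ln T"
        using L \<beta> C1 lnT by (intro mult_right_mono mult_left_mono) (auto simp: X_def)
      moreover have "2 * ((L + \<beta>) * X) + 7 * C1 * ((L + \<beta>) * X) * ln T \<le> C * ((L + \<beta>) * X) * ln T"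
        by (intro absorb_lower_order lnT) (use L \<beta> C1 C2 in \<open>auto simp: X_def C_def\<close>)
      ultimately have "achieves K Ls T (C * ((L + \<beta>) * X) * ln T)"
        by (intro achieves_mono[OF 1]) linarith
      then show ?thesis by (simp add: X_def mult_ac)
    qed

    have concave: "achieves K Ls T (C * L * real T powr ((d+1)/(d+3)) * ln (real T))"
      if conc: "\<forall>l\<in>Ls. concave_on K l"
    proof -
      \<comment> \<open>Balances \<open>\<delta> * T\<close> against
        \<open>sqrt (\<delta> powr (- (d - 1) / 2) * T)\<close>.\<close>
      define \<delta> where "\<delta> = real T powr - (2/(d+3))"
      define X where "X = real T powr ((d+1)/(d+3))"
      have \<delta>: "0 < \<delta>" "\<delta> \<le> 1" unfolding \<delta>_def using small d by auto
      have "K \<noteq> {}" using c by auto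
      moreover have "K \<subseteq> cball c 2" proof
        fix x assume "x \<in> K"
        then show "x \<in> cball c 2" using D[OF c, of x] by simp
      qed
      ultimately have "compact K \<and> convex K \<and> K \<noteq> {} \<and> K \<subseteq> cball c 2 \<and> 0 < \<delta> \<and> \<delta> \<le> 1"
        using K \<delta> by simp
      from dudley[rule_format, OF this] obtain S where S: "finite S" "S \<noteq> {}" "S \<subseteq> K"
          "real (card S) \<le> C0 * \<delta> powr (- (d - 1) / 2)"
        and dense: "\<And>x. x \<in> K \<Longrightarrow> \<exists>x'\<in>convex hull S. dist x x' \<le> \<delta>"
        unfolding d_def by blast
      have q: "\<exists>q. set_pmf q \<subseteq> S \<and> (\<forall>l\<in>Ls. measure_pmf.expectation q l \<le> l y + L * \<delta>)" if y: "y \<in> K" for y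
      proof -
        obtain x' where x': "x' \<in> convex hull S" "dist y x' \<le> \<delta>" using dense[OF y] by blast
        obtain q where q: "set_pmf q \<subseteq> S" "(\<Sum>s\<in>S. pmf q s *\<^sub>R s) = x'"
          using pmf_of_convex_hull[OF S(1) x'(1)] by blast
        then have "dist (\<Sum>s\<in>S. pmf q s *\<^sub>R s) y \<le> \<delta>" using x'(2) by (simp add: dist_commute)
        then show ?thesis
          using expectation_concave_rounding[OF lip _ S(1-3) q(1) y] conc q(1) by blast
      qed
      have "\<delta> powr (- (d - 1) / 2) = T powr ((d-1)/(d+3))"
      proof -
        have "- (2 / b) * (- a / 2) = a / b" for a b :: real by simp
        then show ?thesis unfolding \<delta>_def powr_powr by (rule arg_cong)
      qed
      then have "real (card S) \<le> C2 * T powr ((d-1)/(d+3))"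
        using S(4) C2(2) mult_right_mono[of C0 C2 "T powr ((d-1)/(d+3))"] by simp
      then have ach: "achieves K Ls T (L * \<delta> * T + 7 * C2 * L * T powr ((1 + (d-1)/(d+3)) / 2) * ln T)"
        using d by (intro hedge_rate[OF S(1,3,2) _ C2(1) _ _ L range q T]) auto
      have \<kappa>: "(1 + (d-1)/(d+3)) / 2 = (d+1)/(d+3)" using d by (simp add: field_simps)
      have eT: "\<delta> * T = X"
      proof -
        have "- (2/(d+3)) + 1 = (d+1)/(d+3)" using d by (simp add: field_simps)
        then show ?thesis unfolding \<delta>_def X_def T_mult by simp
      qed
      have "L * \<delta> * T + 7 * C2 * L * T powr ((1 + (d-1)/(d+3)) / 2) * ln T = 1 * (L * X) + 7 * C2 * (L * X) * ln T"
        unfolding \<kappa> X_def[symmetric] eT[symmetric] by (simp add: mult_ac)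
      from ach[unfolded this] have "achieves K Ls T (1 * (L * X) + 7 * C2 * (L * X) * ln T)"
        .
      then have "achieves K Ls T (C * (L * X) * ln T)"
        by (rule achieves_mono) (intro absorb_lower_order lnT, use L C1 C2 in \<open>auto simp: X_def C_def\<close>)
      then show ?thesis by (simp add: X_def mult_ac)
    qed

    have ftl: "achieves K Ls T (16 * card S * (L * (L/\<alpha>)) * ln T + e * T + \<rho>)"
      if S: "finite S" "S \<subseteq> K" "S \<noteq> {}" and \<alpha>: "\<alpha> > 0" "\<forall>l\<in>Ls. strongly_convex_on \<alpha> K l" and \<rho>: "\<rho> > 0"
        and q: "\<And>y. y \<in> K \<Longrightarrow> \<exists>q. set_pmf q \<subseteq> S \<and> (\<forall>l\<in>Ls. measure_pmf.expectation q l \<le> l y + e)"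
      for S \<alpha> \<rho> and e :: real
    proof (rule achieves_mono)
      show "achieves K Ls T (card S * (8 * L\<^sup>2 / \<alpha> * ln (1 + real T)) + e * T + \<rho>)"
        by (rule ftl_achieves[OF S K(1,2) \<alpha>(1) lip _ q \<rho>]) (use \<alpha>(2) lip strongly_convex_midpoint in blast)+
      have "card S * (8 * L\<^sup>2 / \<alpha> * ln (1 + real T)) \<le> card S * (8 * L\<^sup>2 / \<alpha> * (2 * ln T))"
        using \<alpha>(1) by (intro mult_left_mono ln_one_plus_le[OF T]) auto
      also have "\<dots> = 16 * card S * (L * (L/\<alpha>)) * ln T" by (simp add: power2_eq_square)
      finally show "card S * (8 * L\<^sup>2 / \<alpha> * ln (1 + real T)) + e * T + \<rho>
          \<le> 16 * card S * (L * (L/\<alpha>)) * ln T + e * T + \<rho>" by simp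
    qed

    have strong: "achieves K Ls T (C * L * (L/\<alpha>) powr (1/(d+1)) * real T powr (d/(d+1)) * ln (real T))"
      if \<alpha>: "\<alpha> > 0" "\<forall>l\<in>Ls. strongly_convex_on \<alpha> K l" for \<alpha>
    proof -
      define b where "b = L/\<alpha>"
      define X where "X = b powr (1/(d+1)) * real T powr (d/(d+1))"
      have b: "b > 0" using L \<alpha> by (simp add: b_def)
      have X: "X > 0" using b Tr by (simp add: X_def)
      have "achieves K Ls T (C * (L * X) * ln T)"
      \<comment> \<open>If \<open>L / \<alpha> > T\<close> the claimed bound exceeds \<open>L T\<close>, so a rounding set of constant size suffices.\<close>
      proof (cases "b \<le> T")
        case True
        \<comment> \<open>Solves \<open>\<epsilon> * T = \<epsilon> powr (- d) * b\<close>, rounding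
          cost against follow-the-leader cost; \<open>b \<le> T\<close> is what makes it at most
          1.\<close>
        define \<epsilon> where "\<epsilon> = (b / T) powr (1/(d+1))"
        have \<epsilon>: "0 < \<epsilon>" "\<epsilon> \<le> 1"
          unfolding \<epsilon>_def using b Tr d True powr_mono2[of "1/(d+1)" "b / T" 1] by auto
        obtain S where S: "finite S" "S \<subseteq> K" "S \<noteq> {}" "real (card S) \<le> C1 * \<epsilon> powr (- d)"
          and q: "\<And>y. y \<in> K \<Longrightarrow> \<exists>q. set_pmf q \<subseteq> S \<and> (\<forall>l\<in>Ls. measure_pmf.expectation q l \<le> l y + 3 * L * \<epsilon>)"
          using sets[OF \<epsilon>] by blast
        have 1: "1 - 1/(d+1) = d/(d+1)" "1 + - (d/(d+1)) = 1/(d+1)" using d by (simp_all add: field_simps)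
        have \<epsilon>T: "\<epsilon> * T = X"
        proof -
          have "\<epsilon> * T = b powr (1/(d+1)) * (T powr 1 / T powr (1/(d+1)))"
            unfolding \<epsilon>_def using b Tr by (simp add: powr_divide)
          also have "\<dots> = X" unfolding powr_diff[symmetric] 1 X_def ..
          finally show ?thesis .
        qed
        have \<epsilon>b: "\<epsilon> powr (- d) * b = X"
        proof -
          have "\<epsilon> powr (- d) * b = (b / T) powr - (d/(d+1)) * b" unfolding \<epsilon>_def powr_powr by simp
          also have "\<dots> = (b powr 1 * b powr - (d/(d+1))) * T powr (d/(d+1))"
            using b Tr by (simp add: powr_divide powr_minus field_simps)
          also have "\<dots> = X" unfolding powr_add[symmetric] 1 X_def ..
          finally show ?thesis .
        qed
        have "real (card S) * b \<le> C1 * \<epsilon> powr (- d) * b" using S(4) b by (intro mult_right_mono) auto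
        then have Sb: "real (card S) * b \<le> C1 * X" using \<epsilon>b by (simp add: mult.assoc)
        show ?thesis
        proof (rule achieves_mono[OF ftl[OF S(1-3) \<alpha> _ q]])
          show "0 < L * X" using L X by simp
          have "16 * L * ln T * (card S * b) \<le> 16 * L * ln T * (C1 * X)"
            using L lnT by (intro mult_left_mono Sb) auto
          moreover have "4 * (L * X) + 16 * C1 * (L * X) * ln T \<le> C * (L * X) * ln T"
            by (intro absorb_lower_order lnT) (use L X C1 C2 in \<open>auto simp: C_def\<close>)
          ultimately show "16 * card S * (L * (L/\<alpha>)) * ln T + 3 * L * \<epsilon> * T + L * X \<le> C * (L * X) * ln T"
            unfolding b_def[symmetric] \<epsilon>T[symmetric] by (simp add: mult_ac)
        qed
      next
        case False
        obtain S where S: "finite S" "S \<subseteq> K" "S \<noteq> {}" "real (card S) \<le> C1 * 1 powr (- d)"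
          and q: "\<And>y. y \<in> K \<Longrightarrow> \<exists>q. set_pmf q \<subseteq> S \<and> (\<forall>l\<in>Ls. measure_pmf.expectation q l \<le> l y + 3 * L * 1)"
          using sets[of 1] by auto
        have TX: "T \<le> X"
        proof -
          have "1/(d+1) + d/(d+1) = 1" using d by (simp add: add_divide_distrib[symmetric])
          then have "real T = T powr (1/(d+1)) * T powr (d/(d+1))"
            unfolding powr_add[symmetric] by simp
          also have "\<dots> \<le> X" unfolding X_def
            using False d by (intro mult_right_mono powr_mono2) auto
          finally show ?thesis .
        qed
        have "T powr ((1 + 0) / 2) \<le> T powr 1" using Tr by (intro powr_mono) auto
        then have rt: "T powr ((1 + 0) / 2) \<le> X" using TX by simp
        \<comment> \<open>Hedge takes over, with \<open>\<kappa> = 0\<close>: for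
          \<open>b > T\<close> already one follow-the-leader copy would be charged
          \<open>L * b\<close>, more than \<open>L * X\<close>.\<close>
        have 1: "achieves K Ls T (3 * L * 1 * T + 7 * C1 * L * T powr ((1 + 0) / 2) * ln T)"
          by (rule hedge_rate[OF S(1-3) _ C1 _ _ L range q T]) (use S(4) Tr in auto)
        have "3 * L * T \<le> 3 * L * X" "7 * C1 * L * T powr ((1 + 0) / 2) * ln T \<le> 7 * C1 * L * X * ln T"
          using rt TX L C1 lnT by (auto intro!: mult_left_mono mult_right_mono)
        moreover have "3 * (L * X) + 7 * C1 * (L * X) * ln T \<le> C * (L * X) * ln T"
          by (intro absorb_lower_order lnT) (use L X C1 C2 in \<open>auto simp: C_def\<close>)
        ultimately show ?thesis by (intro achieves_mono[OF 1]) (simp add: mult_ac)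
      qed
      then show ?thesis by (simp add: X_def b_def mult_ac)
    qed

    have strong_smooth: "achieves K Ls T (C * L * (\<beta>/L + L/\<alpha>) * real T powr (d/(d+2)) * ln (real T))"
      if \<alpha>\<beta>: "\<alpha> > 0" "\<beta> > 0" "\<forall>l\<in>Ls. strongly_convex_on \<alpha> K l \<and> smooth_on \<beta> K l" for \<alpha> \<beta>
    \<comment> \<open>Comparing \<open>\<alpha>\<close> with \<open>L\<close> requires an actual
      loss; without one every bound holds vacuously.\<close>
    proof (cases "Ls = {}")
      case True
      then show ?thesis using achieves_empty[OF c] T by simp
    next
      case False
      then obtain l where l: "l \<in> Ls" by blast
      define b where "b = L/\<alpha>"
      \<comment> \<open>Balances \<open>\<epsilon>\<^sup>2 * T\<close> against the number
        \<open>\<epsilon> powr (- d)\<close> of copies.\<close>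
      define \<epsilon> where "\<epsilon> = real T powr - (1/(d+2))"
      define X where "X = real T powr (d/(d+2))"
      have b: "b > 0" using L \<alpha>\<beta> by (simp add: b_def)
      have X: "X > 0" using Tr by (simp add: X_def)
      have "\<alpha> \<le> 4 * L" using strong_convexity_le_lipschitz[OF K(1,3) _ lip[OF l]] \<alpha>\<beta>(3) l by blast
      then have b4: "1 \<le> 4 * b" using \<alpha>\<beta>(1) by (simp add: b_def field_simps)
      have \<epsilon>: "0 < \<epsilon>" "\<epsilon> \<le> 1" unfolding \<epsilon>_def using small d by auto
      obtain S where S: "finite S" "S \<subseteq> K" "S \<noteq> {}" "real (card S) \<le> C1 * \<epsilon> powr (- d)"
        and q: "\<forall>\<beta>>0. (\<forall>l\<in>Ls. smooth_on \<beta> K l) \<longrightarrow>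
          (\<forall>y\<in>K. \<exists>q. set_pmf q \<subseteq> S \<and> (\<forall>l\<in>Ls. measure_pmf.expectation q l \<le> l y + 2 * (L + \<beta>) * \<epsilon>\<^sup>2))"
        using sets[OF \<epsilon>] by (elim exE conjE) (rule that)
      note q = q[rule_format, OF \<alpha>\<beta>(2) conjunct2[OF bspec[OF \<alpha>\<beta>(3)]]]
      have "\<epsilon> powr (- d) = X" unfolding \<epsilon>_def X_def by (simp add: powr_powr)
      then have SX: "real (card S) \<le> C1 * X" using S(4) by simp
      have \<epsilon>T: "\<epsilon>\<^sup>2 * T = X"
      proof -
        have e2: "\<epsilon>\<^sup>2 = T powr - (2/(d+2))"
          unfolding \<epsilon>_def power2_eq_square powr_add[symmetric] by (simp add: field_simps)
        have e1: "- (2/(d+2)) + 1 = d/(d+2)" using d by (simp add: field_simps)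
        show ?thesis unfolding e2 T_mult e1 X_def ..
      qed
      define Z where "Z = \<beta> + L * b"
      have Z: "Z > 0" "L * b \<le> Z" using \<alpha>\<beta> L b by (auto simp: Z_def add_pos_pos)
      have "L * 1 \<le> L * (4 * b)" using b4 L by (intro mult_left_mono) auto
      \<comment> \<open>The left side collects the rounding cost \<open>2 * (L + \<beta>)\<close>
        and the slack \<open>L\<close>. The claimed bound has no bare \<open>L\<close>, so it is
        traded for \<open>4 * L * b\<close>.\<close>
      then have LZ: "3 * L + 2 * \<beta> \<le> 12 * Z" using \<alpha>\<beta>(2) by (simp add: Z_def)
      have "achieves K Ls T (C * (Z * X) * ln T)"
      proof (rule achieves_mono[OF ftl[OF S(1-3) \<alpha>\<beta>(1) _ _ q]])
        show "\<forall>l\<in>Ls. strongly_convex_on \<alpha> K l" using \<alpha>\<beta>(3) by blast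
        show "0 < L * X" using L X by simp
        have "card S * (L * b) * (16 * ln T) \<le> (C1 * X) * Z * (16 * ln T)"
          using SX Z L b lnT C1 X by (intro mult_mono mult_right_mono) auto
        moreover have "(3 * L + 2 * \<beta>) * X \<le> 12 * Z * X" using LZ X by (intro mult_right_mono) auto
        moreover have "12 * (Z * X) + 16 * C1 * (Z * X) * ln T \<le> C * (Z * X) * ln T"
          by (intro absorb_lower_order lnT) (use Z X C1 C2 in \<open>auto simp: C_def\<close>)
        moreover have "2 * (L + \<beta>) * \<epsilon>\<^sup>2 * T = 2 * (L + \<beta>) * X" unfolding mult.assoc \<epsilon>T ..
        ultimately show "16 * card S * (L * (L/\<alpha>)) * ln T + 2 * (L + \<beta>) * \<epsilon>\<^sup>2 * T + L * X \<le> C * (Z * X) * ln T"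
          unfolding b_def[symmetric] by (simp add: algebra_simps)
      qed
      moreover have "L * (\<beta>/L + L/\<alpha>) = Z" using L by (simp add: Z_def b_def distrib_left)
      ultimately show ?thesis unfolding mult.assoc[of C L] by (simp add: X_def mult.assoc)
    qed
    show ?case
      unfolding Let_def d_def[symmetric]
      using lipschitz smooth concave strong strong_smooth by simp
  qed
qed

end
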